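(* Suppose that $h$ is a Bregman function with zone $C$, that $f$ is quasi-convex (i.e. its lower level sets are convex), and that $S(P)\neq\emptyset$. Then the dynamical system $(H\text{-}SD)$ $$\dot x(t)+\nabla_Hf_{|\mathcal{F}}(x(t))=0,\quad x(0)=x^0\in\mathcal{F},$$ is well-posed (its maximal solution is defined for all $t\ge0$) and its solution $x(t)$ converges as $t\to+\infty$ to some $x^*\in\overline{\mathcal{F}}$ with $$-\nabla f(x^* )\in N_{\overline{C}}(x^* )+\mathcal{A}_0^\perp.$$ If in addition $f$ is convex, then $x(t)$ converges to a solution of $(P)$.
   Context: Let $m<n$ be positive integers, $A\in\mathbb{R}^{m\times n}$ of full rank, $b\in\operatorname{Im}A$, $\mathcal{A}=\{x\in\mathbb{R}^n: Ax=b\}$, $\mathcal{A}_0=\ker A$, $\mathcal{A}_0^\perp=\operatorname{Im}A^T$. Let $C\subset\mathbb{R}^n$ be nonempty, open and convex, with $\mathcal{F}=C\cap\mathcal{A}\neq\emptyset$ and $\overline{\mathcal{F}}=\overline{C}\cap\mathcal{A}$. The function $f\in\mathcal{C}^1(\mathbb{R}^n)$ has locally Lipschitz continuous gradient $\nabla f$ on $\mathbb{R}^n$. $S(P)$ is the set of optimal solutions of $(P)$: $\inf\{f(x)\mid x\in\overline{C},\ Ax=b\}$. For $x\in\overline{C}$, $N_{\overline{C}}(x)=\{\nu\in\mathbb{R}^n\mid\langle y-x,\nu\rangle\le0\ \forall y\in\overline{C}\}$ is the normal cone. $\Gamma_0(\mathbb{R}^n)$ is the set of lower semicontinuous proper convex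 functions $\mathbb{R}^n\to\mathbb{R}\cup\{+\infty\}$. A function $h\in\Gamma_0(\mathbb{R}^n)$ is essentially smooth if it is differentiable on $\operatorname{int}\operatorname{dom}h$ and $|\nabla h(x^j)|\to+\infty$ for every sequence $(x^j)\subset\operatorname{int}\operatorname{dom}h$ converging to a boundary point of $\operatorname{dom}h$; it is of Legendre type if moreover it is strictly convex on $\operatorname{int}\operatorname{dom}h$. The function $h\in\Gamma_0(\mathbb{R}^n)$ is assumed to satisfy: (i) $h$ is of Legendre type with $\operatorname{int}\operatorname{dom}h=C$; (ii) $h_{|C}\in\mathcal{C}^2(C;\mathbb{R})$ and $\nabla^2h(x)$ is symmetric positive definite for all $x\in C$; (iii) $x\mapsto\nabla^2h(x)$ is locally Lipschitz continuous on $C$. Set $H=\nabla^2h$ on $C$, and $D_h(x,y)=h(x)-h(y)-\langle\nabla h(y),x-y\rangle$ for $x\in\operatorname{dom}h$, $y\in C$. A function $h\in\Gamma_0(\mathbb{R}^n)$ is a Bregman function with zone $C$ if: (i) $\operatorname{dom}h=\overline{C}$, $h$ is continuous and strictly convex on $\overline{C}$ and $h_{|C}\in\mathcal{C}^1(C;\mathbb{R})$; (ii) for all $a\in\overline{C}$ and $\gamma\in\mathbb{R}$, $\{y\in C\mid D_h(a,y)\le\gamma\}$ is bounded; (iii) for all $y\in\overline{C}$ and all sequences $y^j\to y$ with $y^j\in C$, $D_h(y,y^j)\to0$. On the submanifold $\mathcal{F}$, with tangent space $\mathcal{A}_0$, consider the Riemannian metric $(u,v)^H_x=\langle H(x)u,v\rangle$;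 the gradient of $f_{|\mathcal{F}}$ is $\nabla_Hf_{|\mathcal{F}}(x)=H(x)^{-1}[I-A^T(AH(x)^{-1}A^T)^{-1}AH(x)^{-1}]\nabla f(x)$. *)

theory Defs
  imports "HOL-Analysis.Analysis"
begin

section \<open>Gradients and Hessians\<close>

definition grad :: "('a::real_inner \<Rightarrow> real) \<Rightarrow> 'a \<Rightarrow> 'a" where
  "grad g x = (THE D. GDERIV g x :> D)"

definition hess :: "(real^'n \<Rightarrow> real) \<Rightarrow> real^'n \<Rightarrow> real^'n^'n" where
  "hess g x = matrix (frechet_derivative (grad g) (at x))"

text \<open>The following two notions are only used for open sets.\<close>

definition C1_on :: "('a::real_inner) set \<Rightarrow> ('a \<Rightarrow> real) \<Rightarrow> bool" where
  "C1_on S g \<longleftrightarrow> g differentiable_on S \<and> continuous_on S (grad g)"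

definition C2_on :: "(real^'n) set \<Rightarrow> (real^'n \<Rightarrow> real) \<Rightarrow> bool" where
  "C2_on S g \<longleftrightarrow> g differentiable_on S \<and> grad g differentiable_on S \<and> continuous_on S (hess g)"

definition locally_lipschitz_on :: "('a::metric_space) set \<Rightarrow> ('a \<Rightarrow> 'b::metric_space) \<Rightarrow> bool" where
  "locally_lipschitz_on S g \<longleftrightarrow> (\<forall>x\<in>S. \<exists>u>0. \<exists>L. L-lipschitz_on (cball x u \<inter> S) g)"

definition pos_def_matrix :: "real^'n^'n \<Rightarrow> bool" where
  "pos_def_matrix M \<longleftrightarrow> (\<forall>v. v \<noteq> 0 \<longrightarrow> 0 < (M *v v) \<bullet> v)"


section \<open>Convex analysis\<close>

definition strictly_convex_on :: "('a::real_vector) set \<Rightarrow> ('a \<Rightarrow> real) \<Rightarrow> bool" where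
  "strictly_convex_on S g \<longleftrightarrow> convex S \<and>
    (\<forall>x\<in>S. \<forall>y\<in>S. \<forall>u>0. \<forall>v>0. x \<noteq> y \<longrightarrow> u + v = 1 \<longrightarrow>
       g (u *\<^sub>R x + v *\<^sub>R y) < u * g x + v * g y)"

definition quasi_convex :: "('a::real_vector \<Rightarrow> real) \<Rightarrow> bool" where
  "quasi_convex g \<longleftrightarrow> (\<forall>r. convex {x. g x \<le> r})"

definition normal_cone :: "('a::real_inner) set \<Rightarrow> 'a \<Rightarrow> 'a set" where
  "normal_cone S x = {v. \<forall>y\<in>S. (y - x) \<bullet> v \<le> 0}"

definition effective_domain :: "('a \<Rightarrow> ereal) \<Rightarrow> 'a set" where
  "effective_domain h = {x. h x < \<infinity>}"

text \<open>The finite values of \<open>h\<close>; meaningful only on the effective domain.\<close>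

definition fin :: "('a \<Rightarrow> ereal) \<Rightarrow> 'a \<Rightarrow> real" where
  "fin h x = real_of_ereal (h x)"

text \<open>The class \<open>\<Gamma>\<^sub>0\<close>. In the convexity inequality no term \<open>\<infinity> - \<infinity>\<close> occurs since \<open>h\<close> never
  takes the value \<open>-\<infinity>\<close>, and \<open>0 * \<infinity> = 0\<close> holds in the type of extended reals.\<close>

definition Gamma0 :: "('a::real_normed_vector \<Rightarrow> ereal) \<Rightarrow> bool" where
  "Gamma0 h \<longleftrightarrow>
     (\<forall>x. h x \<le> Liminf (at x) h) \<and>
     (\<forall>x. h x \<noteq> -\<infinity>) \<and> effective_domain h \<noteq> {} \<and>
     (\<forall>x y. \<forall>u\<ge>0. \<forall>v\<ge>0. u + v = 1 \<longrightarrow>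
        h (u *\<^sub>R x + v *\<^sub>R y) \<le> ereal u * h x + ereal v * h y)"

definition essentially_smooth :: "('a::real_inner \<Rightarrow> ereal) \<Rightarrow> bool" where
  "essentially_smooth h \<longleftrightarrow>
     fin h differentiable_on interior (effective_domain h) \<and>
     (\<forall>X l. (\<forall>j. X j \<in> interior (effective_domain h)) \<and> l \<in> frontier (effective_domain h) \<and>
            X \<longlonglongrightarrow> l \<longrightarrow>
        filterlim (\<lambda>j. norm (grad (fin h) (X j))) at_top sequentially)"

definition legendre_type :: "('a::real_inner \<Rightarrow> ereal) \<Rightarrow> bool" where
  "legendre_type h \<longleftrightarrow> Gamma0 h \<and> essentially_smooth h \<and>
     strictly_convex_on (interior (effective_domain h)) (fin h)"

text \<open>The Bregman distance, for \<open>x\<close> in the domain of \<open>h\<close> and \<open>y\<close> in its interior.\<close>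

definition bregman_dist :: "('a::real_inner \<Rightarrow> ereal) \<Rightarrow> 'a \<Rightarrow> 'a \<Rightarrow> real" where
  "bregman_dist h x y = fin h x - fin h y - grad (fin h) y \<bullet> (x - y)"

definition bregman_function :: "('a::real_inner) set \<Rightarrow> ('a \<Rightarrow> ereal) \<Rightarrow> bool" where
  "bregman_function C h \<longleftrightarrow> Gamma0 h \<and>
     (effective_domain h = closure C \<and> continuous_on (closure C) (fin h) \<and>
        strictly_convex_on (closure C) (fin h) \<and> C1_on C (fin h)) \<and>
     (\<forall>a\<in>closure C. \<forall>r. bounded {y\<in>C. bregman_dist h a y \<le> r}) \<and>
     (\<forall>y\<in>closure C. \<forall>Y. (\<forall>j. Y j \<in> C) \<and> Y \<longlonglongrightarrow> y \<longrightarrow>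
        (\<lambda>j. bregman_dist h y (Y j)) \<longlonglongrightarrow> 0)"


section \<open>The constrained problem\<close>

definition affine_constraint :: "real^'n^'m \<Rightarrow> real^'m \<Rightarrow> (real^'n) set" where
  "affine_constraint A b = {x. A *v x = b}"

definition mat_kernel :: "real^'n^'m \<Rightarrow> (real^'n) set" where
  "mat_kernel A = {x. A *v x = 0}"

definition feasible :: "real^'n^'m \<Rightarrow> real^'m \<Rightarrow> (real^'n) set \<Rightarrow> (real^'n) set" where
  "feasible A b C = C \<inter> affine_constraint A b"

definition optimal_solutions ::
  "real^'n^'m \<Rightarrow> real^'m \<Rightarrow> (real^'n) set \<Rightarrow> (real^'n \<Rightarrow> real) \<Rightarrow> (real^'n) set" where
  "optimal_solutions A b C f =
     {x \<in> closure C \<inter> affine_constraint A b. \<forall>y \<in> closure C \<inter> affine_constraint A b. f x \<le> f y}"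


section \<open>The Riemannian gradient and the dynamical system\<close>

definition riem_metric ::
  "(real^'n \<Rightarrow> real^'n^'n) \<Rightarrow> real^'n \<Rightarrow> real^'n \<Rightarrow> real^'n \<Rightarrow> real" where
  "riem_metric H x u v = (H x *v u) \<bullet> v"

definition riem_grad ::
  "real^'n^'m \<Rightarrow> (real^'n \<Rightarrow> real^'n^'n) \<Rightarrow> (real^'n \<Rightarrow> real) \<Rightarrow> real^'n \<Rightarrow> real^'n" where
  "riem_grad A H f x =
     (let Hi = matrix_inv (H x) in
      (Hi ** (mat 1 - transpose A ** matrix_inv (A ** Hi ** transpose A) ** A ** Hi)) *v grad f x)"

lemma pos_def_invertible:
  fixes M :: "real^'n^'n"
  assumes "pos_def_matrix M"
  shows "invertible M"
proof -
  have "x = 0" if "M *v x = 0" for x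
    using assms that by (force simp: pos_def_matrix_def)
  then show ?thesis
    by (simp add: invertible_left_inverse matrix_left_invertible_ker)
qed

lemma matrix_inv_both:
  fixes M :: "real^'n^'n"
  assumes "invertible M"
  shows "M ** matrix_inv M = mat 1" "matrix_inv M ** M = mat 1"
  using someI_ex[OF assms[unfolded invertible_def]] by (simp_all add: matrix_inv_def)

lemma transpose_adjoint: "(transpose (A::real^'n^'m) *v w) \<bullet> v = w \<bullet> (A *v v)"
  using dot_lmul_matrix[of w A v] by simp

text \<open>The closed formula indeed gives the gradient for the metric on the tangent space, the
  kernel of \<open>A\<close>: it is tangent and represents the differential of \<open>f\<close> on tangent vectors.\<close>

lemma riem_grad_characterization:
  fixes A :: "real^'n^'m" and H :: "real^'n \<Rightarrow> real^'n^'n"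
  assumes rk: "rank A = CARD('m)" and sym: "transpose (H x) = H x" and pd: "pos_def_matrix (H x)"
  shows "riem_grad A H f x \<in> mat_kernel A"
    and "v \<in> mat_kernel A \<Longrightarrow> riem_metric H x (riem_grad A H f x) v = grad f x \<bullet> v"
proof -
  note [simp del] = transpose_matrix_vector
  define Hi where "Hi = matrix_inv (H x)"
  have HHi: "H x ** Hi = mat 1"
    using matrix_inv_both pos_def_invertible pd by (auto simp: Hi_def)
  define S where "S = A ** Hi ** transpose A"
  have injT: "w = 0" if "transpose A *v w = 0" for w
  proof -
    obtain z where z: "A *v z = w"
      using rk full_rank_surjective[of A] by (metis surjD)
    have "w \<bullet> w = (A *v z) \<bullet> w" by (simp add: z)
    also have "\<dots> = z \<bullet> (transpose A *v w)" by (metis transpose_adjoint inner_commute)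
    finally show "w = 0" using that by simp
  qed
  have "w = 0" if "S *v w = 0" for w
  proof -
    define q where "q = Hi *v (transpose A *v w)"
    have Hq: "H x *v q = transpose A *v w"
      by (simp only: q_def matrix_vector_mul_assoc HHi matrix_mul_assoc matrix_mul_lid)
    have Aq: "A *v q = 0"
      using that by (simp add: q_def S_def matrix_vector_mul_assoc matrix_mul_assoc)
    have "(H x *v q) \<bullet> q = w \<bullet> (A *v q)"
      unfolding Hq by (rule transpose_adjoint)
    then have "q = 0" using Aq pd by (force simp: pos_def_matrix_def)
    then show "w = 0" using Hq injT by simp
  qed
  then have "invertible S"
    by (simp add: invertible_left_inverse matrix_left_invertible_ker)
  then have SSi: "S ** matrix_inv S = mat 1" by (rule matrix_inv_both)
  define p where "p = matrix_inv S *v (A *v (Hi *v grad f x))"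
  have rg: "riem_grad A H f x = Hi *v (grad f x - transpose A *v p)"
    unfolding riem_grad_def Let_def p_def Hi_def[symmetric] S_def[symmetric]
    by (simp add: matrix_vector_mul_assoc[symmetric] matrix_vector_mult_diff_rdistrib)
  have "A *v (Hi *v (transpose A *v p)) = S *v p"
    by (simp add: S_def matrix_vector_mul_assoc matrix_mul_assoc)
  also have "\<dots> = A *v (Hi *v grad f x)"
    unfolding p_def using SSi by (simp add: matrix_vector_mul_assoc matrix_mul_assoc)
  finally show "riem_grad A H f x \<in> mat_kernel A"
    by (simp add: rg mat_kernel_def matrix_vector_mult_diff_distrib)
  show "riem_metric H x (riem_grad A H f x) v = grad f x \<bullet> v" if "v \<in> mat_kernel A"
  proof -
    have "H x *v riem_grad A H f x = grad f x - transpose A *v p"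
      unfolding rg by (simp only: matrix_vector_mul_assoc HHi matrix_vector_mul_lid)
    moreover have "(transpose A *v p) \<bullet> v = p \<bullet> (A *v v)"
      by (metis transpose_adjoint inner_commute)
    ultimately show ?thesis
      using that by (simp add: riem_metric_def mat_kernel_def inner_diff_left)
  qed
qed

text \<open>Solutions on \<open>[0, T)\<close> with \<open>0 < T \<le> \<infinity>\<close>, staying in the manifold on which the vector field
  is defined; at \<open>t = 0\<close> the derivative is one-sided.\<close>

definition hsd_solution ::
  "real^'n^'m \<Rightarrow> real^'m \<Rightarrow> (real^'n) set \<Rightarrow> (real^'n \<Rightarrow> ereal) \<Rightarrow> (real^'n \<Rightarrow> real) \<Rightarrow>
   real^'n \<Rightarrow> ereal \<Rightarrow> (real \<Rightarrow> real^'n) \<Rightarrow> bool" where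
  "hsd_solution A b C h f x0 T x \<longleftrightarrow> 0 < T \<and> x 0 = x0 \<and>
     (\<forall>t. 0 \<le> t \<and> ereal t < T \<longrightarrow> x t \<in> feasible A b C \<and>
        (x has_vector_derivative - riem_grad A (hess (fin h)) f (x t))
          (at t within {s. 0 \<le> s \<and> ereal s < T}))"

definition hsd_maximal_solution ::
  "real^'n^'m \<Rightarrow> real^'m \<Rightarrow> (real^'n) set \<Rightarrow> (real^'n \<Rightarrow> ereal) \<Rightarrow> (real^'n \<Rightarrow> real) \<Rightarrow>
   real^'n \<Rightarrow> ereal \<Rightarrow> (real \<Rightarrow> real^'n) \<Rightarrow> bool" where
  "hsd_maximal_solution A b C h f x0 T x \<longleftrightarrow> hsd_solution A b C h f x0 T x \<and>
     \<not> (\<exists>T' y. T < T' \<and> hsd_solution A b C h f x0 T' y \<and>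
          (\<forall>t. 0 \<le> t \<and> ereal t < T \<longrightarrow> y t = x t))"

text \<open>Well-posedness includes existence and uniqueness of the maximal solution; functions
  representing it are only compared on \<open>[0, \<infinity>)\<close>.\<close>

definition hsd_well_posed ::
  "real^'n^'m \<Rightarrow> real^'m \<Rightarrow> (real^'n) set \<Rightarrow> (real^'n \<Rightarrow> ereal) \<Rightarrow> (real^'n \<Rightarrow> real) \<Rightarrow> bool" where
  "hsd_well_posed A b C h f \<longleftrightarrow> (\<forall>x0 \<in> feasible A b C.
     (\<exists>T x. hsd_maximal_solution A b C h f x0 T x) \<and>
     (\<forall>T x. hsd_maximal_solution A b C h f x0 T x \<longrightarrow> T = \<infinity>) \<and>
     (\<forall>x y. hsd_maximal_solution A b C h f x0 \<infinity> x \<and> hsd_maximal_solution A b C h f x0 \<infinity> y \<longrightarrow>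
        (\<forall>t\<ge>0. x t = y t)))"

end

theory Submission
  imports Defs
begin

text \<open>Along the flow, the derivative of \<open>D\<^sub>h(p, x(t))\<close> is the inner product of \<open>\<nabla>f(x(t))\<close> with
  \<open>p - x(t)\<close>, which by quasi-convexity is nonpositive as long as \<open>f(p) \<le> f(x(t))\<close>. For an optimal
  \<open>p\<close> this bounds the trajectory. Moreover \<open>\<nabla>h(x(t))\<close> moves with velocity \<open>-\<nabla>f(x(t))\<close> modulo the
  orthogonal complement of the kernel of \<open>A\<close>, so it grows at most linearly; since \<open>\<nabla>h\<close> blows up
  at the boundary of \<open>C\<close>, the trajectory stays in a compact subset of \<open>C\<close> on each bounded time
  interval and is global. A cluster point \<open>p\<close> satisfies \<open>f(p) \<le> f(x(t))\<close> for all \<open>t\<close>, hence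
  \<open>D\<^sub>h(p, x(t))\<close> decreases to \<open>0\<close> and \<open>x(t)\<close> converges to \<open>p\<close>. Finally every limit \<open>u\<close> of
  \<open>\<nabla>h(x(t)) / t\<close> is normal to the closure of \<open>C\<close> at \<open>p\<close>, and \<open>u + \<nabla>f(p)\<close> is orthogonal to the
  kernel of \<open>A\<close>.\<close>

section \<open>Derivatives along curves\<close>

text \<open>\<open>grad\<close> is a definite description, so existence and uniqueness of the
  representing vector are both needed; by Riesz representation the vector is
  \<open>adjoint g' 1\<close>.\<close>

lemma has_derivative_grad:
  fixes g :: "'a::euclidean_space \<Rightarrow> real"
  assumes "g differentiable (at x)"
  shows "(g has_derivative (\<lambda>v. grad g x \<bullet> v)) (at x)"
proof -
  obtain g' where g': "(g has_derivative g') (at x)"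
    using assms by (auto simp: differentiable_def)
  then have "linear g'" by (rule has_derivative_linear)
  then have "g' = (\<lambda>v. v \<bullet> adjoint g' 1)"
    using adjoint_works[of g' _ 1] by auto
  with g' have ex: "GDERIV g x :> adjoint g' 1"
    by (simp add: gderiv_def)
  have "D = adjoint g' 1" if "GDERIV g x :> D" for D
  proof -
    have "(\<lambda>v. v \<bullet> D) = (\<lambda>v. v \<bullet> adjoint g' 1)"
      using has_derivative_unique that ex unfolding gderiv_def by blast
    then show ?thesis by (metis vector_eq_ldot)
  qed
  with ex have "GDERIV g x :> grad g x"
    unfolding grad_def by (rule theI)
  then show ?thesis by (simp add: gderiv_def inner_commute)
qed

lemma has_derivative_hess:
  assumes "grad g differentiable (at x)"
  shows "(grad g has_derivative (\<lambda>v. hess g x *v v)) (at x)"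
proof -
  have d: "(grad g has_derivative frechet_derivative (grad g) (at x)) (at x)"
    using assms frechet_derivative_works by blast
  then have "(\<lambda>v. hess g x *v v) = frechet_derivative (grad g) (at x)"
    by (simp add: hess_def fun_eq_iff matrix_works has_derivative_linear)
  with d show ?thesis by simp
qed

lemma has_real_derivative_along_curve:
  assumes "(g has_derivative (\<lambda>v. D \<bullet> v)) (at (x t))" "(x has_vector_derivative x') (at t within S)"
  shows "((\<lambda>t. g (x t)) has_real_derivative D \<bullet> x') (at t within S)"
  using has_derivative_compose[OF assms(2)[unfolded has_vector_derivative_def] assms(1)]
  by (simp add: has_field_derivative_def mult_commute_abs)

lemma nonincreasing_if_derivative_nonpos:
  fixes g :: "real \<Rightarrow> real"
  assumes "a \<le> b" "\<And>t. a \<le> t \<Longrightarrow> t \<le> b \<Longrightarrow> (g has_real_derivative g' t) (at t within {a..b})"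
    and "\<And>t. a \<le> t \<Longrightarrow> t \<le> b \<Longrightarrow> g' t \<le> 0"
  shows "g b \<le> g a"
proof (cases "a = b")
  case False
  with assms(1) have "a < b" by simp
  then obtain t where t: "t \<in> {a<..<b}" "g b - g a = g' t * (b - a)"
    using mvt_simple[of a b g "\<lambda>t d. g' t * d"] assms(2)
    by (auto simp: has_field_derivative_def mult_commute_abs)
  then have "g' t * (b - a) \<le> 0"
    using assms(3)[of t] \<open>a < b\<close> by (simp add: mult_le_0_iff)
  with t show ?thesis by simp
qed simp

text \<open>The left side is the right-hand limit of difference quotients along the segment. This
  serves three times: for convexity of \<open>h\<close>, for quasi-convexity of \<open>f\<close>
  (with \<open>c = 0\<close>) and for convexity of \<open>f\<close>.\<close>

lemma inner_grad_le_of_segment: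
  fixes g :: "'a::real_inner \<Rightarrow> real"
  assumes "(g has_derivative (\<lambda>v. D \<bullet> v)) (at y)"
    and "\<And>s. 0 < s \<Longrightarrow> s \<le> 1 \<Longrightarrow> g (y + s *\<^sub>R (m - y)) \<le> g y + s * c"
  shows "D \<bullet> (m - y) \<le> c"
proof -
  have "((\<lambda>s. y + s *\<^sub>R (m - y)) has_vector_derivative (m - y)) (at 0 within {0..})"
    by (auto intro!: derivative_eq_intros)
  then have "((\<lambda>s. g (y + s *\<^sub>R (m - y))) has_real_derivative D \<bullet> (m - y)) (at 0 within {0..})"
    by (rule has_real_derivative_along_curve[rotated]) (simp add: assms)
  then have "((\<lambda>s. (g (y + s *\<^sub>R (m - y)) - g y) / s) \<longlongrightarrow> D \<bullet> (m - y)) (at_right 0)"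
    by (auto simp: has_field_derivative_iff intro: tendsto_within_subset)
  moreover have "\<forall>\<^sub>F s in at_right 0. (g (y + s *\<^sub>R (m - y)) - g y) / s \<le> c"
    unfolding eventually_at_right_field
    using assms(2) by (intro exI[of _ 1]) (auto simp: divide_le_eq algebra_simps)
  ultimately show ?thesis
    by (rule tendsto_upperbound) simp
qed

section \<open>Ordinary differential equations\<close>

lemma lipschitz_on_compact_if_locally:
  assumes "locally_lipschitz_on S g" "compact K" "K \<subseteq> S"
  shows "\<exists>L. L-lipschitz_on K g"
proof -
  \<comment> \<open>The general notion concerns time-dependent fields; a one-point time set reduces
    it to the autonomous case.\<close>
  have "local_lipschitz {0::real} S (\<lambda>_. g)"
    using assms(1) unfolding locally_lipschitz_on_def local_lipschitz_def by blast
  then have "local_lipschitz {0::real} K (\<lambda>_. g)"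
    using assms(3) local_lipschitz_subset by blast
  then show ?thesis
    using local_lipschitz_compact_implies_lipschitz[where X = K and T = "{0::real}" and f = "\<lambda>_. g"] assms(2)
    by auto
qed

text \<open>Banach's fixed point theorem for \<open>w(t) = exp(-l t) y(t)\<close>: the weight makes the integral
  operator a contraction on the whole half-line.\<close>

lemma global_picard:
  fixes G :: "'a::euclidean_space \<Rightarrow> 'a"
  assumes lip: "L-lipschitz_on UNIV G" and bdd: "bounded (range G)"
  shows "\<exists>y. y 0 = x0 \<and> (\<forall>t\<ge>0. (y has_vector_derivative G (y t)) (at t within {0..}))"
proof -
  have "L \<ge> 0" using lip by (rule lipschitz_on_nonneg)
  \<comment> \<open>The contraction factor will be \<open>L / l\<close>, at most 1/2; the summand 1
    keeps \<open>l\<close> positive even when \<open>L = 0\<close>.\<close>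
  define l where "l = 2 * L + 1"
  have l: "l > 0" "2 * L \<le> l" using \<open>L \<ge> 0\<close> by (auto simp: l_def)
  obtain M where M: "\<And>z. norm (G z) \<le> M" using bdd by (auto simp: bounded_iff)
  have contG: "continuous_on UNIV G" using lip by (rule lipschitz_on_continuous_on)
  define F where "F w s = G (exp (l * s) *\<^sub>R apply_bcontfun w s)" for w and s :: real
  define Y where "Y w t = x0 + integral {0..t} (F w)" for w t
  \<comment> \<open>Freezing negative times at 0 yields a bounded continuous function on the whole
    line.\<close>
  define P where "P w t = exp (- (l * max 0 t)) *\<^sub>R Y w (max 0 t)" for w t
  have contF: "continuous_on S (F w)" for w S
    unfolding F_def by (intro continuous_on_compose2[OF contG] continuous_intros) auto
  have intF: "F w integrable_on {0..t}" for w t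
    by (intro integrable_continuous_real contF)
  have derY: "(Y w has_vector_derivative F w t) (at t within {0..})" if "t \<ge> 0" for w t
  proof -
    have "((\<lambda>t. integral {0..t} (F w)) has_vector_derivative F w t) (at t within {0..t+1})"
      using that by (intro integral_has_vector_derivative contF) auto
    moreover have "at t within {0..t+1} = at t within {0..}"
      by (rule at_within_nhd[of _ "{..<t+1}"]) auto
    ultimately show ?thesis
      unfolding Y_def by (auto intro!: derivative_eq_intros)
  qed
  have contP: "continuous_on UNIV (P w)" for w
  proof -
    have "continuous_on {0..} (Y w)"
      using derY by (auto simp: continuous_on_eq_continuous_within intro: has_vector_derivative_continuous)
    then have "continuous_on UNIV (\<lambda>t. Y w (max 0 t))"
      by (rule continuous_on_compose2) (auto intro: continuous_intros)
    then show ?thesis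
      unfolding P_def by (intro continuous_on_scaleR) (auto intro!: continuous_intros)
  qed
  have bdP: "norm (P w t) \<le> norm x0 + M / l" for w t
  proof -
    define u where "u = max 0 t"
    have u: "u \<ge> 0" by (simp add: u_def)
    have "M \<ge> 0" using M norm_ge_zero order_trans by blast
    have "norm (integral {0..u} (F w)) \<le> M * (u - 0)"
      using u contF M by (intro integral_bound) (auto simp: F_def)
    then have "norm (Y w u) \<le> norm x0 + M * u"
      unfolding Y_def using norm_triangle_ineq[of x0 "integral {0..u} (F w)"] by simp
    then have "norm (P w t) \<le> exp (- (l * u)) * (norm x0 + M * u)"
      by (simp add: P_def u_def[symmetric])
    \<comment> \<open>The linear growth of \<open>Y w\<close> is absorbed by the weight:
      \<open>l * u\<close> never exceeds \<open>exp (l * u)\<close>, so the bound is uniform in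
      time.\<close>
    also have "\<dots> = exp (- (l * u)) * norm x0 + M / l * (l * u / exp (l * u))"
      using l by (simp add: exp_minus field_simps)
    also have "\<dots> \<le> 1 * norm x0 + M / l * 1"
    proof (intro add_mono mult_mono)
      show "l * u / exp (l * u) \<le> 1"
        using exp_ge_add_one_self[of "l * u"] by (simp add: divide_le_eq del: exp_ge_add_one_self)
    qed (use l u \<open>M \<ge> 0\<close> in auto)
    finally show ?thesis by simp
  qed
  have Pb: "P w \<in> bcontfun" for w
    using contP bdP by (auto simp: bcontfun_def bounded_iff)
  define Q where "Q w = Bcontfun (P w)" for w
  have Q: "apply_bcontfun (Q w) = P w" for w
    unfolding Q_def using Pb by (simp add: Bcontfun_inverse)
  have contr: "dist (Q w) (Q v) \<le> 1/2 * dist w v" for w v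
  proof (rule dist_bound)
    fix t :: real
    define u where "u = max 0 t"
    have u: "u \<ge> 0" by (simp add: u_def)
    define d where "d = dist w v"
    have Fd: "norm (F w s - F v s) \<le> L * d * exp (l * s)" for s
    proof -
      have "norm (F w s - F v s) \<le> L * dist (exp (l * s) *\<^sub>R apply_bcontfun w s) (exp (l * s) *\<^sub>R apply_bcontfun v s)"
        unfolding F_def dist_norm[symmetric] by (rule lipschitz_onD[OF lip]) auto
      also have "\<dots> = L * (exp (l * s) * dist (apply_bcontfun w s) (apply_bcontfun v s))"
        by (simp add: dist_norm scaleR_diff_right[symmetric])
      also have "\<dots> \<le> L * (exp (l * s) * d)"
        unfolding d_def using \<open>L \<ge> 0\<close> by (intro mult_left_mono dist_bounded) auto
      finally show ?thesis by (simp add: mult_ac)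
    qed
    \<comment> \<open>Integrating the weight divides by \<open>l\<close>, which is the source of the
      factor \<open>L / l\<close>.\<close>
    have ie: "((\<lambda>s. L * d * exp (l * s)) has_integral (L * d / l * exp (l * u) - L * d / l * exp (l * 0))) {0..u}"
      using u l by (intro fundamental_theorem_of_calculus)
        (auto intro!: derivative_eq_intros simp: has_real_derivative_iff_has_vector_derivative[symmetric])
    have "norm (integral {0..u} (\<lambda>s. F w s - F v s)) \<le> integral {0..u} (\<lambda>s. L * d * exp (l * s))"
      using Fd ie by (intro integral_norm_bound_integral integrable_diff intF) auto
    also have "\<dots> = L * d / l * exp (l * u) - L * d / l"
      unfolding integral_unique[OF ie] by simp
    also have "\<dots> \<le> L * d / l * exp (l * u)"
      using l \<open>L \<ge> 0\<close> by (simp add: d_def)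
    finally have "norm (Y w u - Y v u) \<le> L * d / l * exp (l * u)"
      by (simp add: Y_def Henstock_Kurzweil_Integration.integral_diff intF)
    then have "exp (- (l * u)) * norm (Y w u - Y v u) \<le> exp (- (l * u)) * (L * d / l * exp (l * u))"
      by (intro mult_left_mono) auto
    then have "norm (P w t - P v t) \<le> exp (- (l * u)) * (L * d / l * exp (l * u))"
      by (simp only: P_def u_def[symmetric] scaleR_diff_right[symmetric] norm_scaleR abs_exp_cancel)
    also have "\<dots> = L / l * d"
      by (simp add: exp_minus)
    also have "\<dots> \<le> 1/2 * d"
      using l by (intro mult_right_mono) (auto simp: d_def field_simps)
    finally show "dist (apply_bcontfun (Q w) t) (apply_bcontfun (Q v) t) \<le> 1/2 * dist w v"
      by (simp add: Q dist_norm d_def)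
  qed
  then obtain w where w: "Q w = w"
    using banach_fix_type[of "1/2" Q] by auto
  have wt: "exp (l * t) *\<^sub>R apply_bcontfun w t = Y w t" if "t \<ge> 0" for t
  proof -
    have "apply_bcontfun w t = P w t" using Q w by metis
    then show ?thesis using that by (simp add: P_def exp_minus)
  qed
  show ?thesis
  proof (intro exI[of _ "Y w"] conjI allI impI)
    show "Y w 0 = x0" by (simp add: Y_def)
    show "(Y w has_vector_derivative G (Y w t)) (at t within {0..})" if "t \<ge> 0" for t
      using derY[OF that, of w] wt[OF that] by (simp add: F_def)
  qed
qed

text \<open>The squared norm has derivative at most \<open>2 * L\<close> times itself, so the weight
  \<open>exp (- (2 * L * s))\<close> makes it nonincreasing, and it starts at 0.\<close>

lemma gronwall_zero:
  fixes z :: "real \<Rightarrow> 'a::euclidean_space"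
  assumes "0 \<le> t" and "\<And>s. 0 \<le> s \<Longrightarrow> s \<le> t \<Longrightarrow> (z has_vector_derivative z' s) (at s within {0..t})"
    and "\<And>s. 0 \<le> s \<Longrightarrow> s \<le> t \<Longrightarrow> norm (z' s) \<le> L * norm (z s)" and "z 0 = 0"
  shows "z t = 0"
proof -
  let ?g = "\<lambda>s. exp (- (2 * L * s)) * (z s \<bullet> z s)"
  have "?g t \<le> ?g 0"
  proof (rule nonincreasing_if_derivative_nonpos[OF assms(1)])
    fix s assume s: "0 \<le> s" "s \<le> t"
    let ?d = "exp (- (2 * L * s)) * (2 * (z s \<bullet> z' s) - 2 * L * (z s \<bullet> z s))"
    have "((\<lambda>s. z s \<bullet> z s) has_real_derivative 2 * (z s \<bullet> z' s)) (at s within {0..t})"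
      using has_derivative_inner[OF assms(2)[OF s, unfolded has_vector_derivative_def]
          assms(2)[OF s, unfolded has_vector_derivative_def]]
      unfolding has_field_derivative_def
      by (rule has_derivative_eq_rhs) (simp add: fun_eq_iff inner_commute algebra_simps)
    then show "(?g has_real_derivative ?d) (at s within {0..t})"
      by (auto intro!: derivative_eq_intros simp: algebra_simps)
    have "z s \<bullet> z' s \<le> norm (z s) * norm (z' s)" by (rule norm_cauchy_schwarz)
    also have "\<dots> \<le> norm (z s) * (L * norm (z s))" using assms(3)[OF s] by (simp add: mult_left_mono)
    also have "\<dots> = L * (z s \<bullet> z s)" by (simp add: dot_square_norm power2_eq_square)
    finally show "?d \<le> 0" by (simp add: mult_le_0_iff)
  qed
  then show ?thesis using assms(4)
    by (simp add: mult_le_0_iff dot_square_norm)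
qed

section \<open>The Riemannian gradient on compact sets\<close>

text \<open>The norm on matrices is the Frobenius norm, so Cauchy-Schwarz on each row
  suffices.\<close>

lemma norm_matrix_vector_mult_le: "norm (M *v v) \<le> norm M * norm v" for M :: "real^'n^'m"
proof -
  have "norm (M *v v) \<le> L2_set (\<lambda>i. norm v * norm (M $ i)) UNIV"
    unfolding norm_vec_def[of "M *v v"]
    using Cauchy_Schwarz_ineq2[of "M $ _" v]
    by (intro L2_set_mono) (auto simp: matrix_vector_mul_component mult.commute)
  then show ?thesis
    by (simp add: norm_vec_def[of M] L2_set_right_distrib mult.commute)
qed

lemma bounded_bilinear_matrix_vector_mult:
  "bounded_bilinear ((*v) :: real^'n^'m \<Rightarrow> real^'n \<Rightarrow> real^'m)"
proof
  show "\<exists>K. \<forall>(M::real^'n^'m) v. norm (M *v v) \<le> norm M * norm v * K"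
    by (intro exI[of _ 1]) (simp add: norm_matrix_vector_mult_le)
qed (simp_all add: matrix_vector_right_distrib matrix_vector_mult_add_rdistrib
    scaleR_matrix_vector_assoc matrix_vector_mult_scaleR)

text \<open>The quadratic form attains a minimum on the product of \<open>K\<close> with the unit
  sphere. This minimum is positive and serves as \<open>c\<close>; homogeneity of degree 2 extends
  the bound to all \<open>v\<close>.\<close>

lemma uniformly_coercive_on_compact:
  fixes H :: "'a::t2_space \<Rightarrow> real^'n^'n"
  assumes "compact K" "continuous_on K H" and pd: "\<And>x. x \<in> K \<Longrightarrow> pos_def_matrix (H x)"
  shows "\<exists>c>0. \<forall>x\<in>K. \<forall>v. c * (norm v)\<^sup>2 \<le> (H x *v v) \<bullet> v"
proof (cases "K = {}")
  case False
  let ?q = "\<lambda>p. (H (fst p) *v snd p) \<bullet> snd p"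
  have "continuous_on (K \<times> sphere 0 1) (\<lambda>p. H (fst p))"
    by (rule continuous_on_compose2[OF assms(2)]) (auto intro: continuous_intros)
  then have "continuous_on (K \<times> sphere 0 1) ?q"
    by (intro continuous_on_inner bounded_bilinear.continuous_on[OF bounded_bilinear_matrix_vector_mult]
        continuous_intros)
  moreover have "compact (K \<times> sphere (0::real^'n) 1)" "K \<times> sphere (0::real^'n) 1 \<noteq> {}"
    using assms(1) False by (simp_all add: compact_Times)
  ultimately obtain p where p: "p \<in> K \<times> sphere 0 1" "\<And>q. q \<in> K \<times> sphere 0 1 \<Longrightarrow> ?q p \<le> ?q q"
    using continuous_attains_inf[of "K \<times> sphere 0 1" ?q] by blast
  show ?thesis
  proof (intro exI[of _ "?q p"] conjI ballI allI)
    show "?q p > 0"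
    proof -
      have "fst p \<in> K" "snd p \<noteq> 0" using p(1) by (auto simp: mem_Times_iff)
      then show ?thesis using pd unfolding pos_def_matrix_def by blast
    qed
    fix x v assume x: "x \<in> K"
    show "?q p * (norm v)\<^sup>2 \<le> (H x *v v) \<bullet> v"
    proof (cases "v = 0")
      case False
      have "?q p \<le> ?q (x, v /\<^sub>R norm v)"
        using False x by (intro p(2)) auto
      also have "\<dots> = ((H x *v v) \<bullet> v) / (norm v)\<^sup>2"
        by (simp add: matrix_vector_mult_scaleR power2_eq_square divide_inverse mult_ac)
      finally show ?thesis
        using False by (simp add: pos_le_divide_eq)
    qed simp
  qed
qed (auto intro: exI[of _ 1])

text \<open>Testing the characterisation of two gradients against their difference avoids any
  estimate on matrix inverses.\<close>

lemma riem_grad_lipschitz_on_compact: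
  fixes A :: "real^'n^'m" and H :: "real^'n \<Rightarrow> real^'n^'n"
  assumes rk: "rank A = CARD('m)" and K: "compact K"
    and H: "L-lipschitz_on K H" and g: "L'-lipschitz_on K (grad f)"
    and sym: "\<And>x. x \<in> K \<Longrightarrow> transpose (H x) = H x"
    and pd: "\<And>x. x \<in> K \<Longrightarrow> pos_def_matrix (H x)"
  shows "\<exists>B. B-lipschitz_on K (riem_grad A H f)"
proof -
  let ?r = "riem_grad A H f"
  obtain c where c: "c > 0" "\<And>x v. x \<in> K \<Longrightarrow> c * (norm v)\<^sup>2 \<le> (H x *v v) \<bullet> v"
    using uniformly_coercive_on_compact[OF K lipschitz_on_continuous_on[OF H] pd] by blast
  have "compact (grad f ` K)"
    using compact_continuous_image[OF lipschitz_on_continuous_on[OF g] K] .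
  then obtain M where M: "M > 0" "\<And>x. x \<in> K \<Longrightarrow> norm (grad f x) \<le> M"
    using compact_imp_bounded[THEN bounded_normE, of "grad f ` K"] by (metis imageI)
  have ker: "?r x \<in> mat_kernel A" if "x \<in> K" for x
    using riem_grad_characterization(1) rk sym pd that by blast
  have rep: "(H x *v ?r x) \<bullet> v = grad f x \<bullet> v" if "x \<in> K" "v \<in> mat_kernel A" for x v
    using riem_grad_characterization(2) rk sym pd that unfolding riem_metric_def by blast
  \<comment> \<open>The gradient is tested against itself, so coercivity gives
    \<open>c * (norm (?r x))\<^sup>2\<close> \<le> \<open>M * norm (?r x)\<close>.\<close>
  have bound: "c * norm (?r x) \<le> M" if "x \<in> K" for x
  proof (cases "?r x = 0")
    case False
    have "c * (norm (?r x))\<^sup>2 \<le> grad f x \<bullet> ?r x"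
      using c(2)[OF that] rep[OF that ker[OF that]] by metis
    also have "\<dots> \<le> norm (grad f x) * norm (?r x)" by (rule norm_cauchy_schwarz)
    also have "\<dots> \<le> M * norm (?r x)" using M(2)[OF that] by (simp add: mult_right_mono)
    finally have "c * norm (?r x) * norm (?r x) \<le> M * norm (?r x)"
      by (simp add: power2_eq_square mult_ac)
    then show ?thesis using False by simp
  qed (use M in simp)
  have L: "L \<ge> 0" "L' \<ge> 0" using H g lipschitz_on_nonneg by auto
  have "dist (?r x) (?r y) \<le> ((L' + L * (M / c)) / c) * dist x y" if xy: "x \<in> K" "y \<in> K" for x y
  proof -
    define v where "v = ?r x - ?r y"
    have v: "v \<in> mat_kernel A"
      using ker[OF xy(1)] ker[OF xy(2)]
      by (simp add: v_def mat_kernel_def matrix_vector_mult_diff_distrib)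
    have "c * norm v * norm v \<le> (H x *v v) \<bullet> v"
      using c(2)[OF xy(1), of v] by (simp add: power2_eq_square mult_ac)
    \<comment> \<open>Writing \<open>H x *v ?r y\<close> as
      \<open>H y *v ?r y + (H x - H y) *v ?r y\<close> makes the characterisation usable at both
      points.\<close>
    also have "\<dots> = (grad f x - grad f y) \<bullet> v + ((H y - H x) *v ?r y) \<bullet> v"
      using rep[OF xy(1) v] rep[OF xy(2) v]
      by (simp add: v_def[symmetric] inner_diff_left matrix_vector_mult_diff_rdistrib)
        (simp add: v_def matrix_vector_mult_diff_distrib inner_diff_left)
    also have "\<dots> \<le> (L' * dist x y) * norm v + (L * dist x y * (M / c)) * norm v"
    proof (intro add_mono order_trans[OF norm_cauchy_schwarz] mult_right_mono)
      show "norm (grad f x - grad f y) \<le> L' * dist x y"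
        using lipschitz_onD[OF g xy] by (simp add: dist_norm)
      have "norm (H y - H x) \<le> L * dist x y"
        using lipschitz_onD[OF H xy] by (simp add: dist_norm norm_minus_commute)
      moreover have "norm (?r y) \<le> M / c"
        using bound[OF xy(2)] c(1) by (simp add: field_simps)
      ultimately show "norm ((H y - H x) *v ?r y) \<le> L * dist x y * (M / c)"
        using L by (intro order_trans[OF norm_matrix_vector_mult_le] mult_mono) auto
    qed auto
    finally have "c * norm v * norm v \<le> ((L' + L * (M / c)) * dist x y) * norm v"
      by (simp add: algebra_simps)
    then have "c * norm v \<le> (L' + L * (M / c)) * dist x y"
      using L M c by (cases "v = 0") auto
    then show ?thesis
      using c(1) by (simp add: v_def[symmetric] dist_norm[of "?r x"] field_simps)
  qed
  then show ?thesis
    using L M c by (intro exI[of _ "(L' + L * (M / c)) / c"] lipschitz_onI) auto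
qed

section \<open>Bregman distance and a priori bounds\<close>

lemma strictly_convex_onD:
  assumes "strictly_convex_on S g" "x \<in> S" "y \<in> S" "x \<noteq> y" "u > 0" "v > 0" "u + v = 1"
  shows "g (u *\<^sub>R x + v *\<^sub>R y) < u * g x + v * g y"
  using assms by (simp add: strictly_convex_on_def)

locale hessian_gradient_flow =
  fixes A :: "real^'n^'m" and b :: "real^'m" and C :: "(real^'n) set"
    and f :: "real^'n \<Rightarrow> real" and h :: "real^'n \<Rightarrow> ereal"
  assumes rank_A: "rank A = CARD('m)"
    and open_C: "open C" and convex_C: "convex C"
    and closure_feasible: "closure (feasible A b C) = closure C \<inter> affine_constraint A b"
    and C1_f: "C1_on UNIV f" and lipschitz_grad_f: "locally_lipschitz_on UNIV (grad f)"
    and smooth_h: "essentially_smooth h" and interior_dom: "interior (effective_domain h) = C"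
    and C2_h: "C2_on C (fin h)"
    and hess_h: "\<forall>x\<in>C. transpose (hess (fin h) x) = hess (fin h) x \<and> pos_def_matrix (hess (fin h) x)"
    and lipschitz_hess_h: "locally_lipschitz_on C (hess (fin h))"
    and bregman_h: "bregman_function C h"
    and quasi_convex_f: "quasi_convex f"
    and solvable: "optimal_solutions A b C f \<noteq> {}"
begin

abbreviation "F \<equiv> feasible A b C"
abbreviation "q \<equiv> grad (fin h)"
abbreviation "H \<equiv> hess (fin h)"
abbreviation "V \<equiv> riem_grad A H f"
abbreviation "D \<equiv> bregman_dist h"

lemma feasibleD: "x \<in> F \<Longrightarrow> x \<in> C" "x \<in> F \<Longrightarrow> A *v x = b"
  by (auto simp: feasible_def affine_constraint_def)

lemma closure_C: "x \<in> C \<Longrightarrow> x \<in> closure C"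
  using closure_subset by blast

lemma diff_in_kernel: "A *v x = b \<Longrightarrow> A *v y = b \<Longrightarrow> x - y \<in> mat_kernel A"
  by (simp add: mat_kernel_def matrix_vector_mult_diff_distrib)

lemma derivative_f: "(f has_derivative (\<lambda>v. grad f x \<bullet> v)) (at x)"
  using C1_f by (intro has_derivative_grad) (simp add: C1_on_def differentiable_on_def)

lemma continuous_f: "continuous_on S f"
  using derivative_f by (meson continuous_at_imp_continuous_on has_derivative_continuous)

lemma continuous_grad_f: "continuous_on S (grad f)"
  using C1_f continuous_on_subset unfolding C1_on_def by blast

lemma derivative_h: "x \<in> C \<Longrightarrow> (fin h has_derivative (\<lambda>v. q x \<bullet> v)) (at x)"
  using C2_h open_C unfolding C2_on_def
  by (intro has_derivative_grad) (auto simp: differentiable_on_eq_differentiable_at)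

lemma derivative_q: "x \<in> C \<Longrightarrow> (q has_derivative (\<lambda>v. H x *v v)) (at x)"
  using C2_h open_C unfolding C2_on_def
  by (intro has_derivative_hess) (auto simp: differentiable_on_eq_differentiable_at)

lemma continuous_q: "continuous_on C q"
  using derivative_q by (meson continuous_at_imp_continuous_on has_derivative_continuous)

section \<open>Consequences of the Bregman property and of quasi-convexity\<close>

lemma dom_h: "effective_domain h = closure C"
  and continuous_h: "continuous_on (closure C) (fin h)"
  and strictly_convex_h: "strictly_convex_on (closure C) (fin h)"
  and bounded_sublevel_D: "p \<in> closure C \<Longrightarrow> bounded {y\<in>C. D p y \<le> r}"
  and D_tendsto_zero: "p \<in> closure C \<Longrightarrow> (\<And>j. Y j \<in> C) \<Longrightarrow> Y \<longlonglongrightarrow> p \<Longrightarrow> (\<lambda>j. D p (Y j)) \<longlonglongrightarrow> 0"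
  using bregman_h unfolding bregman_function_def by auto

text \<open>Only the base point has to lie in \<open>C\<close>; \<open>m\<close> may be a boundary
  point, since convexity on the closure controls the whole segment.\<close>

lemma h_above_tangent:
  assumes "y \<in> C" "m \<in> closure C"
  shows "q y \<bullet> (m - y) \<le> fin h m - fin h y"
proof (rule inner_grad_le_of_segment[OF derivative_h[OF assms(1)]])
  fix s :: real assume s: "0 < s" "s \<le> 1"
  show "fin h (y + s *\<^sub>R (m - y)) \<le> fin h y + s * (fin h m - fin h y)"
  \<comment> \<open>Strict convexity asks for distinct endpoints and positive weights; in the
    excluded cases equality holds.\<close>
  proof (cases "s = 1 \<or> m = y")
    case False
    then have "fin h (s *\<^sub>R m + (1 - s) *\<^sub>R y) < s * fin h m + (1 - s) * fin h y"
      using assms s closure_C by (intro strictly_convex_onD[OF strictly_convex_h]) auto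
    then show ?thesis by (simp add: algebra_simps)
  qed auto
qed

lemma D_nonneg: "y \<in> C \<Longrightarrow> p \<in> closure C \<Longrightarrow> D p y \<ge> 0"
  using h_above_tangent[of y p] by (simp add: bregman_dist_def)

text \<open>The segment from \<open>x\<close> to \<open>p\<close> stays in the convex sublevel set
  of level \<open>f x\<close>.\<close>

lemma grad_f_toward_sublevel: "f p \<le> f x \<Longrightarrow> grad f x \<bullet> (p - x) \<le> 0"
proof (rule inner_grad_le_of_segment[OF derivative_f])
  fix s :: real assume s: "0 < s" "s \<le> 1" and p: "f p \<le> f x"
  have "convex {z. f z \<le> f x}" using quasi_convex_f by (simp add: quasi_convex_def)
  then have "(1 - s) *\<^sub>R x + s *\<^sub>R p \<in> {z. f z \<le> f x}"
    using s p by (intro convexD) auto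
  then show "f (x + s *\<^sub>R (p - x)) \<le> f x + s * 0" by (simp add: algebra_simps)
qed

text \<open>Converse of the third Bregman axiom. If convergence failed, bounded sublevel sets would
  give a subsequence away from \<open>p\<close> with a limit \<open>l\<close>, along which both
  \<open>D p\<close> and \<open>D l\<close> tend to 0; the tangent inequality at the midpoint of
  \<open>p\<close> and \<open>l\<close> and strict convexity then force
  \<open>p = l\<close>.\<close>

lemma D_tendsto_zero_imp_tendsto:
  assumes p: "p \<in> closure C" and Y: "\<And>j. Y j \<in> C" and lim: "(\<lambda>j. D p (Y j)) \<longlonglongrightarrow> 0"
  shows "Y \<longlonglongrightarrow> p"
proof (rule ccontr)
  obtain g where g: "\<And>j. \<bar>D p (Y j)\<bar> \<le> g"
    using convergent_imp_Bseq[OF convergentI[OF lim]] by (auto simp: Bseq_def)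
  have "range Y \<subseteq> {y\<in>C. D p y \<le> g}"
    using g Y abs_le_D1 by auto
  then have bY: "bounded (range Y)"
    using bounded_sublevel_D[OF p] bounded_subset by blast
  assume "\<not> Y \<longlonglongrightarrow> p"
  then obtain e where e: "e > 0" "\<not> (\<forall>\<^sub>F j in sequentially. dist (Y j) p < e)"
    by (auto simp: tendsto_iff)
  then obtain r :: "nat \<Rightarrow> nat" where r: "strict_mono r" "\<And>n. \<not> dist (Y (r n)) p < e"
    using not_eventually_sequentiallyD by blast
  have "bounded (range (Y \<circ> r))" using bY by (rule bounded_subset) auto
  then obtain l s where s: "strict_mono s" "((Y \<circ> r) \<circ> s) \<longlonglongrightarrow> l"
    using bounded_imp_convergent_subsequence by blast
  define Z where "Z = (Y \<circ> r) \<circ> s"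
  have Z: "Z \<longlonglongrightarrow> l" "\<And>j. Z j \<in> C" using s Y by (auto simp: Z_def)
  have l: "l \<in> closure C" using Z closure_sequential by blast
  have Dl: "(\<lambda>j. D l (Z j)) \<longlonglongrightarrow> 0" by (rule D_tendsto_zero[OF l Z(2) Z(1)])
  have Dp: "(\<lambda>j. D p (Z j)) \<longlonglongrightarrow> 0"
    using LIMSEQ_subseq_LIMSEQ[OF LIMSEQ_subseq_LIMSEQ[OF lim r(1)] s(1)] by (simp add: Z_def o_def)
  have hZ: "(\<lambda>j. fin h (Z j)) \<longlonglongrightarrow> fin h l"
    using continuous_h l Z closure_C unfolding continuous_on_sequentially o_def by blast
  define m where "m = (1/2) *\<^sub>R p + (1/2) *\<^sub>R l"
  have m: "m \<in> closure C"
    unfolding m_def using p l convex_closure[OF convex_C] by (intro convexD) auto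
  have "(\<lambda>j. ((fin h p - fin h (Z j) - D p (Z j)) + (fin h l - fin h (Z j) - D l (Z j))) / 2)
      \<longlonglongrightarrow> ((fin h p - fin h l - 0) + (fin h l - fin h l - 0)) / 2"
    by (intro tendsto_intros Dl Dp hZ) simp
  moreover have "((fin h p - fin h y - D p y) + (fin h l - fin h y - D l y)) / 2 \<le> fin h m - fin h y"
    if "y \<in> C" for y
  proof -
    have "q y \<bullet> (m - y) = (q y \<bullet> (p - y) + q y \<bullet> (l - y)) / 2"
      by (simp add: m_def inner_diff_right inner_add_right field_simps)
    then show ?thesis using h_above_tangent[OF that m] by (simp add: bregman_dist_def)
  qed
  moreover have "(\<lambda>j. fin h m - fin h (Z j)) \<longlonglongrightarrow> fin h m - fin h l"
    by (intro tendsto_intros hZ)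
  \<comment> \<open>In the limit \<open>fin h m\<close> is at least the mean of
    \<open>fin h p\<close> and \<open>fin h l\<close>.\<close>
  ultimately have "((fin h p - fin h l - 0) + (fin h l - fin h l - 0)) / 2 \<le> fin h m - fin h l"
    using Z(2) by (intro LIMSEQ_le) auto
  then have "1/2 * fin h p + 1/2 * fin h l \<le> fin h m" by (simp add: field_simps)
  moreover have "fin h m < 1/2 * fin h p + 1/2 * fin h l" if "p \<noteq> l"
    unfolding m_def using p l that by (intro strictly_convex_onD[OF strictly_convex_h]) auto
  ultimately have "p = l" by (meson not_less)
  moreover have "\<forall>\<^sub>F j in sequentially. dist (Z j) l < e" using Z(1) e(1) by (simp add: tendsto_iff)
  ultimately show False using r(2) by (auto simp: Z_def eventually_sequentially)
qed

text \<open>This set will trap trajectories. A limit of its points cannot lie on the boundary of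
  \<open>C\<close>, because essential smoothness would make \<open>q\<close> unbounded along the
  sequence.\<close>

lemma compact_bounded_gradient:
  "compact {x \<in> C. norm x \<le> R \<and> norm (q x) \<le> c}" (is "compact ?K")
proof -
  have "?K \<subseteq> cball 0 R" by auto
  then have "bounded ?K" using bounded_cball bounded_subset by blast
  moreover have "closed ?K"
    unfolding closed_sequential_limits
  proof (intro allI impI, elim conjE)
    fix X l assume X: "\<forall>n. X n \<in> ?K" "X \<longlonglongrightarrow> l"
    then have "l \<in> closure C" unfolding closure_sequential by blast
    have "l \<in> C"
    proof (rule ccontr)
      assume "l \<notin> C"
      then have "l \<in> frontier (effective_domain h)"
        using \<open>l \<in> closure C\<close> interior_dom dom_h by (simp add: frontier_def)
      then have "filterlim (\<lambda>j. norm (q (X j))) at_top sequentially"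
        using X smooth_h interior_dom unfolding essentially_smooth_def by blast
      then have "\<forall>\<^sub>F j in sequentially. c + 1 \<le> norm (q (X j))"
        by (auto simp: filterlim_at_top)
      then obtain j where "c + 1 \<le> norm (q (X j))" by (auto simp: eventually_sequentially)
      moreover have "norm (q (X j)) \<le> c" using X(1) by simp
      ultimately show False by simp
    qed
    moreover have "norm l \<le> R"
      using X by (intro LIMSEQ_le_const2[OF tendsto_norm[OF X(2)]]) auto
    moreover have "(\<lambda>n. q (X n)) \<longlonglongrightarrow> q l"
      using continuous_q \<open>l \<in> C\<close> X unfolding continuous_on_sequentially o_def by blast
    then have "norm (q l) \<le> c"
      using X by (intro LIMSEQ_le_const2[OF tendsto_norm]) auto
    ultimately show "l \<in> ?K" by simp
  qed
  ultimately show ?thesis by (simp add: compact_eq_bounded_closed)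
qed

section \<open>The vector field on \<open>C\<close> and monotone quantities along its
  trajectories\<close>

lemma V_in_kernel: "x \<in> C \<Longrightarrow> A *v V x = 0"
  using riem_grad_characterization(1)[of A H x f] rank_A hess_h by (simp add: mat_kernel_def)

text \<open>Through this identity the derivatives of \<open>q\<close> and \<open>D p\<close> along
  the flow involve only \<open>grad f\<close>, with no matrix inverse.\<close>

lemma hess_V: "x \<in> C \<Longrightarrow> v \<in> mat_kernel A \<Longrightarrow> (H x *v V x) \<bullet> v = grad f x \<bullet> v"
  using riem_grad_characterization(2)[of A H x v f] rank_A hess_h by (simp add: riem_metric_def)

lemma V_lipschitz_on_compact:
  assumes "compact K" "K \<subseteq> C"
  shows "\<exists>L. L-lipschitz_on K V"
proof -
  obtain L L' where "L-lipschitz_on K H" "L'-lipschitz_on K (grad f)"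
    using lipschitz_on_compact_if_locally assms lipschitz_hess_h lipschitz_grad_f by (meson subset_UNIV)
  then show ?thesis
    using riem_grad_lipschitz_on_compact[OF rank_A assms(1)] assms(2) hess_h by blast
qed

text \<open>An arbitrary time set treats compact intervals, the half-line and \<open>[0, T)\<close>
  alike; at endpoints belonging to it the derivative is one-sided.\<close>

definition flow_on :: "real set \<Rightarrow> (real \<Rightarrow> real^'n) \<Rightarrow> bool" where
  "flow_on S x \<longleftrightarrow> (\<forall>t\<in>S. x t \<in> F \<and> (x has_vector_derivative - V (x t)) (at t within S))"

lemma flow_on_subset: "flow_on S x \<Longrightarrow> T \<subseteq> S \<Longrightarrow> flow_on T x"
  unfolding flow_on_def by (meson has_vector_derivative_within_subset subsetD)

lemma flow_onD:
  assumes "flow_on S x" "t \<in> S"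
  shows "x t \<in> F" "x t \<in> C" "A *v x t = b" "(x has_vector_derivative - V (x t)) (at t within S)"
  using assms feasibleD by (auto simp: flow_on_def)

lemma flow_on_continuous: "flow_on S x \<Longrightarrow> continuous_on S x"
  unfolding flow_on_def continuous_on_eq_continuous_within
  by (meson has_vector_derivative_continuous)

text \<open>The derivative of \<open>f\<close> along the flow is minus the squared Riemannian length
  of \<open>V\<close>.\<close>

lemma f_nonincreasing:
  assumes "flow_on {s..t} x" "s \<le> t"
  shows "f (x t) \<le> f (x s)"
proof (rule nonincreasing_if_derivative_nonpos[OF assms(2)])
  fix u assume "s \<le> u" "u \<le> t"
  then have u: "u \<in> {s..t}" by simp
  note xu = flow_onD[OF assms(1) u]
  show "((\<lambda>u. f (x u)) has_real_derivative grad f (x u) \<bullet> - V (x u)) (at u within {s..t})"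
    by (rule has_real_derivative_along_curve[OF derivative_f xu(4)])
  have "V (x u) \<in> mat_kernel A" using V_in_kernel xu(2) by (simp add: mat_kernel_def)
  then have "grad f (x u) \<bullet> V (x u) = (H (x u) *v V (x u)) \<bullet> V (x u)"
    using hess_V xu(2) by simp
  also have "\<dots> \<ge> 0"
    using hess_h xu(2) by (cases "V (x u) = 0") (auto simp: pos_def_matrix_def less_imp_le)
  finally show "grad f (x u) \<bullet> - V (x u) \<le> 0" by simp
qed

lemma has_derivative_q_along_flow:
  assumes "flow_on S x" "t \<in> S"
  shows "((\<lambda>t. q (x t)) has_vector_derivative - (H (x t) *v V (x t))) (at t within S)"
  using has_derivative_compose[OF flow_onD(4)[OF assms, unfolded has_vector_derivative_def]
      derivative_q[OF flow_onD(2)[OF assms]]]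
  by (simp add: has_vector_derivative_def matrix_vector_mult_scaleR linear_neg[OF matrix_vector_mul_linear])

lemma has_derivative_q_inner_along_flow:
  assumes "flow_on S x" "t \<in> S" "v \<in> mat_kernel A"
  shows "((\<lambda>t. q (x t) \<bullet> v) has_real_derivative - (grad f (x t) \<bullet> v)) (at t within S)"
proof -
  have "((\<lambda>y. y \<bullet> v) has_derivative (\<lambda>y. v \<bullet> y)) (at (q (x t)))"
    by (auto intro!: derivative_eq_intros simp: inner_commute)
  from has_real_derivative_along_curve[where x = "\<lambda>t. q (x t)", OF this has_derivative_q_along_flow[OF assms(1,2)]]
  show ?thesis
    using hess_V[OF flow_onD(2)[OF assms(1,2)] assms(3)] by (simp add: inner_commute)
qed

text \<open>The two terms \<open>q (x t) \<bullet> V (x t)\<close> cancel. What remains pairs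
  \<open>H V\<close> with \<open>p - x t\<close>, a kernel vector because both points satisfy the
  constraint.\<close>

lemma has_derivative_D_along_flow:
  assumes "flow_on S x" "t \<in> S" "A *v p = b"
  shows "((\<lambda>t. D p (x t)) has_real_derivative grad f (x t) \<bullet> (p - x t)) (at t within S)"
proof -
  note xt = flow_onD[OF assms(1,2)]
  have "((\<lambda>t. fin h (x t)) has_real_derivative q (x t) \<bullet> - V (x t)) (at t within S)"
    by (rule has_real_derivative_along_curve[OF derivative_h[OF xt(2)] xt(4)])
  moreover have "((\<lambda>t. q (x t) \<bullet> (p - x t)) has_real_derivative
      q (x t) \<bullet> V (x t) - (H (x t) *v V (x t)) \<bullet> (p - x t)) (at t within S)"
  proof -
    have "((\<lambda>t. p - x t) has_vector_derivative V (x t)) (at t within S)"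
      using xt(4) by (auto intro!: derivative_eq_intros)
    from has_derivative_inner[OF has_derivative_q_along_flow[OF assms(1,2), unfolded has_vector_derivative_def]
        this[unfolded has_vector_derivative_def]]
    show ?thesis unfolding has_field_derivative_def
      by (rule has_derivative_eq_rhs) (simp add: fun_eq_iff algebra_simps)
  qed
  ultimately have "((\<lambda>t. fin h p - fin h (x t) - q (x t) \<bullet> (p - x t)) has_real_derivative
      (H (x t) *v V (x t)) \<bullet> (p - x t)) (at t within S)"
    by (auto intro!: derivative_eq_intros)
  then show ?thesis
    using hess_V[OF xt(2) diff_in_kernel[OF assms(3) xt(3)]] by (simp add: bregman_dist_def)
qed

text \<open>Comparing \<open>f p\<close> with \<open>f\<close> at the final time is enough:
  \<open>f\<close> is at least as large at all earlier times.\<close>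

lemma D_nonincreasing:
  assumes "flow_on {s..t} x" "s \<le> t" "A *v p = b" "f p \<le> f (x t)"
  shows "D p (x t) \<le> D p (x s)"
proof (rule nonincreasing_if_derivative_nonpos[OF assms(2)])
  fix u assume u: "s \<le> u" "u \<le> t"
  show "((\<lambda>u. D p (x u)) has_real_derivative grad f (x u) \<bullet> (p - x u)) (at u within {s..t})"
    using has_derivative_D_along_flow assms u by simp
  have "f (x t) \<le> f (x u)"
    using u by (intro f_nonincreasing flow_on_subset[OF assms(1)]) auto
  then show "grad f (x u) \<bullet> (p - x u) \<le> 0"
    using assms(4) by (intro grad_f_toward_sublevel) simp
qed

section \<open>A priori bounds and uniqueness\<close>

lemma flow_bounded:
  "\<exists>R>0. \<forall>t\<ge>0. \<forall>x. flow_on {0..t} x \<and> x 0 = x0 \<longrightarrow> norm (x t) \<le> R"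
proof -
  obtain p where p: "p \<in> closure C" "A *v p = b" "\<And>y. y \<in> F \<Longrightarrow> f p \<le> f y"
    using solvable closure_C
    by (fastforce simp: optimal_solutions_def affine_constraint_def feasible_def)
  \<comment> \<open>\<open>p\<close> is optimal, so \<open>D p\<close> never increases and every
    trajectory from \<open>x0\<close> stays in one bounded sublevel set; hence \<open>R\<close>
    depends neither on the time nor on the trajectory.\<close>
  obtain R where R: "R > 0" "\<And>y. y \<in> C \<Longrightarrow> D p y \<le> D p x0 \<Longrightarrow> norm y \<le> R"
    using bounded_sublevel_D[OF p(1), of "D p x0"] by (auto simp: bounded_pos)
  have "norm (x t) \<le> R" if "t \<ge> 0" "flow_on {0..t} x" "x 0 = x0" for t x
  proof -
    have "x t \<in> F" using flow_onD(1)[OF that(2), of t] that(1) by simp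
    then show ?thesis
      using D_nonincreasing[OF that(2,1) p(2) p(3)] feasibleD that(3) by (auto intro: R(2))
  qed
  then show ?thesis using R(1) by auto
qed

text \<open>Convexity of \<open>h\<close> between \<open>x t\<close> and the boundary point of a ball around \<open>x0\<close> in direction
  \<open>q (x t)\<close> bounds \<open>norm (q (x t))\<close> in terms of \<open>q (x t) \<bullet> (x t - x0)\<close>, where \<open>x t - x0\<close> is in the kernel of
  \<open>A\<close>; so this inner product changes only at the rate of \<open>grad f\<close>.\<close>

lemma flow_gradient_bound:
  assumes x0: "x0 \<in> F"
  shows "\<exists>c0\<ge>0. \<exists>c1\<ge>0. \<forall>t\<ge>0. \<forall>x. flow_on {0..t} x \<and> x 0 = x0 \<longrightarrow> norm (q (x t)) \<le> c0 + c1 * t"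
proof -
  obtain R where R: "R > 0" "\<And>t x. t \<ge> 0 \<Longrightarrow> flow_on {0..t} x \<Longrightarrow> x 0 = x0 \<Longrightarrow> norm (x t) \<le> R"
    using flow_bounded by meson
  obtain e where e: "e > 0" "cball x0 e \<subseteq> C"
    using feasibleD(1)[OF x0] open_C by (meson open_contains_cball)
  have "compact (grad f ` cball 0 R)"
    by (intro compact_continuous_image continuous_grad_f compact_cball)
  then obtain M where M: "M > 0" "\<And>y. norm y \<le> R \<Longrightarrow> norm (grad f y) \<le> M"
    using compact_imp_bounded[THEN bounded_normE, of "grad f ` cball 0 R"] by (metis imageI mem_cball_0)
  \<comment> \<open>One bound on \<open>fin h\<close> has to cover both the region reached by
    trajectories and the ball containing the test point \<open>y\<close>.\<close>
  have sub: "(closure C \<inter> cball 0 R) \<union> cball x0 e \<subseteq> closure C"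
    using e(2) closure_C by blast
  have "compact (fin h ` ((closure C \<inter> cball 0 R) \<union> cball x0 e))"
    by (intro compact_continuous_image continuous_on_subset[OF continuous_h sub] compact_Un
        closed_Int_compact) auto
  then obtain B where B: "B > 0" "\<And>y. y \<in> (closure C \<inter> cball 0 R) \<union> cball x0 e \<Longrightarrow> \<bar>fin h y\<bar> \<le> B"
    using compact_imp_bounded[THEN bounded_normE] by (metis imageI real_norm_def)
  define c0 where "c0 = (2 * B + norm (q x0) * (norm x0 + R)) / e"
  define c1 where "c1 = M * (norm x0 + R) / e"
  have "norm (q (x t)) \<le> c0 + c1 * t" if t: "t \<ge> 0" and x: "flow_on {0..t} x" "x 0 = x0" for t x
  proof (cases "q (x t) = 0")
    case True
    then show ?thesis using t R(1) M(1) B(1) e(1) by (simp add: c0_def c1_def)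
  next
    case False
    have xt: "x t \<in> F" "x t \<in> C" using flow_onD[OF x(1), of t] t by auto
    have Rs: "norm (x s) \<le> R" if "0 \<le> s" "s \<le> t" for s
      using that by (intro R(2) flow_on_subset[OF x(1)] x(2)) auto
    \<comment> \<open>The direction is frozen at the final time \<open>t\<close>, so only
      \<open>q (x s)\<close> varies when differentiating in \<open>s\<close>.\<close>
    define v where "v = x0 - x t"
    have v: "v \<in> mat_kernel A"
      unfolding v_def using x0 xt(1) feasibleD by (intro diff_in_kernel) auto
    have "- (q (x t) \<bullet> v) - M * norm v * t \<le> - (q (x 0) \<bullet> v) - M * norm v * 0"
    proof (rule nonincreasing_if_derivative_nonpos[OF t, of "\<lambda>s. - (q (x s) \<bullet> v) - M * norm v * s"])
      fix s assume s: "0 \<le> s" "s \<le> t"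
      show "((\<lambda>s. - (q (x s) \<bullet> v) - M * norm v * s) has_real_derivative grad f (x s) \<bullet> v - M * norm v)
          (at s within {0..t})"
        using has_derivative_q_inner_along_flow[OF x(1) _ v, of s] s
        by (auto intro!: derivative_eq_intros)
      have "grad f (x s) \<bullet> v \<le> norm (grad f (x s)) * norm v" by (rule norm_cauchy_schwarz)
      also have "\<dots> \<le> M * norm v" using M(2)[OF Rs[OF s]] by (simp add: mult_right_mono)
      finally show "grad f (x s) \<bullet> v - M * norm v \<le> 0" by simp
    qed
    moreover have "- (q (x 0) \<bullet> v) \<le> norm (q x0) * norm v"
      using norm_cauchy_schwarz[of "- q x0" v] x(2) by simp
    ultimately have "- (q (x t) \<bullet> v) \<le> (norm (q x0) + M * t) * norm v"
      by (simp add: algebra_simps)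
    also have "\<dots> \<le> (norm (q x0) + M * t) * (norm x0 + R)"
      unfolding v_def using Rs[of t] norm_triangle_ineq4[of x0 "x t"] t M(1)
      by (intro mult_left_mono) auto
    finally have v2: "- (q (x t) \<bullet> v) \<le> (norm (q x0) + M * t) * (norm x0 + R)" .
    \<comment> \<open>Chosen so that \<open>q (x t) \<bullet> (y - x0)\<close> equals
      \<open>e * norm (q (x t))\<close>.\<close>
    define y where "y = x0 + (e / norm (q (x t))) *\<^sub>R q (x t)"
    have y: "y \<in> cball x0 e" using e(1) False by (simp add: y_def dist_norm)
    have "e * norm (q (x t)) + q (x t) \<bullet> v = q (x t) \<bullet> (y - x t)"
      using False by (simp add: y_def v_def algebra_simps dot_square_norm power2_eq_square)
    also have "\<dots> \<le> fin h y - fin h (x t)"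
      using y e(2) closure_C by (intro h_above_tangent xt) auto
    also have "\<dots> \<le> 2 * B"
    proof -
      have "\<bar>fin h y\<bar> \<le> B" "\<bar>fin h (x t)\<bar> \<le> B"
        using y xt(2) closure_C Rs[of t] t by (auto intro!: B(2))
      then show ?thesis by linarith
    qed
    finally have "e * norm (q (x t)) \<le> 2 * B + (norm (q x0) + M * t) * (norm x0 + R)"
      using v2 by linarith
    moreover have "c0 + c1 * t = (2 * B + (norm (q x0) + M * t) * (norm x0 + R)) / e"
      by (simp add: c0_def c1_def algebra_simps flip: add_divide_distrib)
    ultimately show ?thesis
      using e(1) by (simp add: pos_le_divide_eq mult.commute)
  qed
  moreover have "c0 \<ge> 0" "c1 \<ge> 0" using R(1) M(1) B(1) e(1) by (simp_all add: c0_def c1_def)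
  ultimately show ?thesis by blast
qed

text \<open>Both traces lie in a compact subset of \<open>C\<close>, where \<open>V\<close> is
  Lipschitz, so the Gronwall argument applies to the difference.\<close>

lemma flow_unique:
  assumes "t \<ge> 0" and x: "flow_on {0..t} x" and y: "flow_on {0..t} y" and "x 0 = y 0"
  shows "x t = y t"
proof -
  let ?K = "x ` {0..t} \<union> y ` {0..t}"
  have "compact ?K"
    using x y by (intro compact_Un compact_continuous_image flow_on_continuous) auto
  moreover have "?K \<subseteq> C"
    using x y by (auto intro: flow_onD)
  ultimately obtain L where L: "L-lipschitz_on ?K V"
    using V_lipschitz_on_compact by blast
  have "x t - y t = 0"
  proof (rule gronwall_zero[OF assms(1)])
    fix s assume s: "0 \<le> s" "s \<le> t"
    show "((\<lambda>s. x s - y s) has_vector_derivative - V (x s) - - V (y s)) (at s within {0..t})"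
      using s by (intro has_vector_derivative_diff flow_onD[OF x] flow_onD[OF y]) auto
    have "dist (V (x s)) (V (y s)) \<le> L * dist (x s) (y s)"
      using s by (intro lipschitz_onD[OF L]) auto
    then show "norm (- V (x s) - - V (y s)) \<le> L * norm (x s - y s)"
      by (simp add: dist_norm norm_minus_commute)
  qed (use assms(4) in simp)
  then show ?thesis by simp
qed

section \<open>Global existence\<close>

text \<open>The vector field is composed with the projection onto a compact convex neighbourhood of a set
  that traps every trajectory up to time \<open>T\<close>; the resulting solution cannot leave it.\<close>

lemma flow_exists_on_interval:
  assumes x0: "x0 \<in> F" and "T > 0"
  shows "\<exists>y. y 0 = x0 \<and> flow_on {0..T} y"
proof -
  obtain R where R: "\<And>t x. t \<ge> 0 \<Longrightarrow> flow_on {0..t} x \<Longrightarrow> x 0 = x0 \<Longrightarrow> norm (x t) \<le> R"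
    using flow_bounded by meson
  obtain c0 c1 where c: "c1 \<ge> 0" "\<And>t x. t \<ge> 0 \<Longrightarrow> flow_on {0..t} x \<Longrightarrow> x 0 = x0 \<Longrightarrow> norm (q (x t)) \<le> c0 + c1 * t"
    using flow_gradient_bound[OF x0] by meson
  define K where "K = insert x0 {x \<in> C. norm x \<le> R \<and> norm (q x) \<le> c0 + c1 * T}"
  have K: "compact K" "K \<subseteq> C" "x0 \<in> K"
    unfolding K_def using compact_bounded_gradient feasibleD(1)[OF x0] by auto
  have stays: "x t \<in> K" if "0 \<le> t" "t \<le> T" "flow_on {0..t} x" "x 0 = x0" for t x
  proof -
    have "c0 + c1 * t \<le> c0 + c1 * T" using that(2) c(1) by (simp add: mult_left_mono)
    then have "norm (q (x t)) \<le> c0 + c1 * T" using c(2)[of t x] that by simp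
    then show ?thesis
      using R[of t x] flow_onD(2)[OF that(3), of t] that by (simp add: K_def)
  qed
  define K1 where "K1 = convex hull K"
  have K1: "compact K1" "K1 \<subseteq> C" "K \<subseteq> K1" "convex K1"
    unfolding K1_def using K convex_C by (auto simp: compact_convex_hull hull_subset hull_minimal)
  obtain e where e: "e > 0" "(\<Union>x\<in>K1. cball x e) \<subseteq> C"
    using compact_subset_open_imp_cball_epsilon_subset[OF K1(1) open_C K1(2)] by blast
  \<comment> \<open>Thickening the convex hull preserves convexity and compactness, stays inside
    \<open>C\<close>, and places \<open>K\<close> in the interior.\<close>
  define K' where "K' = (\<Union>x\<in>K1. cball x e)"
  have "K' = K1 + cball 0 e"
    unfolding K'_def by (force simp: set_plus_def dist_norm norm_minus_commute intro: add_diff_cancel_left')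
  then have "convex K'" using K1(4) by (simp add: convex_set_plus)
  have "compact K'" unfolding K'_def by (rule compact_minkowski_sum_cball[OF K1(1)])
  have "K' \<subseteq> C" using e(2) by (simp add: K'_def)
  have int: "K \<subseteq> interior K'"
  proof
    fix x assume "x \<in> K"
    then have "ball x e \<subseteq> K'" using K1(3) ball_subset_cball unfolding K'_def by blast
    then show "x \<in> interior K'" using e(1) by (meson centre_in_ball interiorI open_ball)
  qed
  have "closed K'" "K' \<noteq> {}"
    using \<open>compact K'\<close> compact_imp_closed K(3) int interior_subset by auto
  note cp = \<open>convex K'\<close> \<open>closed K'\<close> \<open>K' \<noteq> {}\<close>
  obtain L where L: "L-lipschitz_on K' V"
    using V_lipschitz_on_compact \<open>compact K'\<close> \<open>K' \<subseteq> C\<close> by blast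
  \<comment> \<open>Projection onto a closed convex set is nonexpansive, so \<open>G\<close> is
    globally Lipschitz; on \<open>K'\<close> it coincides with \<open>- V\<close>.\<close>
  define G where "G z = - V (closest_point K' z)" for z
  have in_K': "closest_point K' z \<in> K'" for z
    by (rule closest_point_in_set[OF cp(2,3)])
  have "L-lipschitz_on UNIV G"
  proof (rule lipschitz_onI)
    fix z w
    have "dist (G z) (G w) \<le> L * dist (closest_point K' z) (closest_point K' w)"
      unfolding G_def dist_minus by (rule lipschitz_onD[OF L in_K' in_K'])
    also have "\<dots> \<le> L * dist z w"
      using lipschitz_on_nonneg[OF L] closest_point_lipschitz[OF cp] by (simp add: mult_left_mono)
    finally show "dist (G z) (G w) \<le> L * dist z w" .
  qed (rule lipschitz_on_nonneg[OF L])
  moreover have "bounded (range G)"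
  proof -
    have "compact ((\<lambda>z. - V z) ` K')"
      using \<open>compact K'\<close> lipschitz_on_continuous_on[OF L]
      by (intro compact_continuous_image continuous_intros)
    then show ?thesis
      using in_K' by (intro bounded_subset[OF compact_imp_bounded]) (auto simp: G_def)
  qed
  ultimately obtain y where y: "y 0 = x0"
    "\<And>t. t \<ge> 0 \<Longrightarrow> (y has_vector_derivative G (y t)) (at t within {0..})"
    using global_picard by meson
  have cont: "continuous_on {0..} y"
    unfolding continuous_on_eq_continuous_within
    using y(2) has_vector_derivative_continuous by fastforce
  \<comment> \<open>\<open>G\<close> takes values in the kernel of \<open>A\<close> everywhere, so
    the constraint persists even where \<open>y\<close> might leave \<open>K'\<close>; Gronwall is
    used with constant 0.\<close>
  have Ay: "A *v y t = b" if "t \<ge> 0" for t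
  proof -
    have "A *v (y t - y 0) = 0"
    proof (rule gronwall_zero[OF that, of _ "\<lambda>_. 0" 0])
      fix s assume s: "0 \<le> s" "s \<le> t"
      have "((\<lambda>s. A *v (y s - y 0)) has_vector_derivative A *v (G (y s) - 0)) (at s within {0..t})"
        by (intro bounded_linear.has_vector_derivative[OF matrix_vector_mul_bounded_linear]
            has_vector_derivative_diff has_vector_derivative_const
            has_vector_derivative_within_subset[OF y(2)[OF s(1)]]) auto
      moreover have "A *v G (y s) = 0"
        using V_in_kernel[of "closest_point K' (y s)"] in_K'[of "y s"] \<open>K' \<subseteq> C\<close>
        by (auto simp: G_def linear_neg[OF matrix_vector_mul_linear])
      ultimately show "((\<lambda>s. A *v (y s - y 0)) has_vector_derivative 0) (at s within {0..t})"
        by simp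
    qed auto
    then show ?thesis
      using feasibleD(2)[OF x0] y(1) by (simp add: matrix_vector_mult_diff_distrib)
  qed
  have flow: "flow_on {0..t} y" if "\<And>s. 0 \<le> s \<Longrightarrow> s \<le> t \<Longrightarrow> y s \<in> K'" for t
    unfolding flow_on_def
  proof
    fix s assume "s \<in> {0..t}"
    then have s: "0 \<le> s" "y s \<in> K'" using that by auto
    then have "G (y s) = - V (y s)" by (simp add: G_def closest_point_self)
    then show "y s \<in> F \<and> (y has_vector_derivative - V (y s)) (at s within {0..t})"
      using has_vector_derivative_within_subset[OF y(2)[OF s(1)], of "{0..t}"] Ay[OF s(1)] s \<open>K' \<subseteq> C\<close>
      by (auto simp: feasible_def affine_constraint_def)
  qed
  \<comment> \<open>At a first exit time \<open>m\<close>, the curve is a genuine trajectory on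
    \<open>[0, m)\<close> and so lies in \<open>K\<close>; as \<open>K\<close> is closed,
    \<open>y m\<close> is in \<open>K\<close> as well, hence interior to \<open>K'\<close>.\<close>
  have inside: "y t \<in> interior K'" if "0 \<le> t" "t \<le> T" for t
  proof (rule ccontr)
    assume "y t \<notin> interior K'"
    define E where "E = {0..T} \<inter> y -` (- interior K')"
    have "closed E"
      unfolding E_def by (intro continuous_closed_preimage continuous_on_subset[OF cont]) auto
    moreover have "t \<in> E" using that \<open>y t \<notin> interior K'\<close> by (simp add: E_def)
    moreover have bdd: "bdd_below E" by (auto simp: E_def)
    ultimately have E: "Inf E \<in> E" using closed_contains_Inf by blast
    define m where "m = Inf E"
    have m: "0 \<le> m" "m \<le> T" "y m \<notin> interior K'" using E by (auto simp: E_def m_def)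
    have before: "y s \<in> interior K'" if "0 \<le> s" "s < m" for s
      using cInf_lower[OF _ bdd, of s] that m(2) by (force simp: E_def m_def)
    have "m \<noteq> 0" using m(3) y(1) K(3) int by auto
    then have "m > 0" using m(1) by simp
    have "y s \<in> K" if s: "0 \<le> s" "s < m" for s
      using s m(2) before interior_subset y(1) by (intro stays flow) fastforce+
    then have "y ` {0..<m} \<subseteq> K" by auto
    then have "y ` closure {0..<m} \<subseteq> K"
      using \<open>m > 0\<close> compact_imp_closed[OF K(1)] continuous_on_subset[OF cont, of "{0..m}"]
      by (intro image_closure_subset) auto
    then have "y m \<in> K" using \<open>m > 0\<close> by auto
    then show False using m(3) int by auto
  qed
  have "flow_on {0..T} y"
    using inside interior_subset by (intro flow) blast
  then show ?thesis using y(1) by blast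
qed

lemma flow_exists:
  assumes "x0 \<in> F"
  shows "\<exists>y. y 0 = x0 \<and> flow_on {0..} y"
proof -
  \<comment> \<open>The extra 1 leaves room to the right of every \<open>t\<close> \<le>
    \<open>real n\<close>, so that derivatives within the interval agree with those within the
    half-line.\<close>
  have "\<forall>n::nat. \<exists>y. y 0 = x0 \<and> flow_on {0..real n + 1} y"
    using flow_exists_on_interval[OF assms] by (simp add: add_nonneg_pos)
  then obtain X where X: "\<And>n::nat. X n 0 = x0" "\<And>n. flow_on {0..real n + 1} (X n)"
    by metis
  define x where "x t = X (nat \<lceil>t\<rceil>) t" for t
  have eq: "x t = X n t" if "0 \<le> t" "t \<le> real n + 1" for t n
    unfolding x_def
  proof (rule flow_unique[where x = "X (nat \<lceil>t\<rceil>)" and y = "X n", OF that(1)])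
    have "t \<le> real (nat \<lceil>t\<rceil>)" by (rule real_nat_ceiling_ge)
    then show "flow_on {0..t} (X (nat \<lceil>t\<rceil>))"
      by (intro flow_on_subset[OF X(2)]) auto
    show "flow_on {0..t} (X n)"
      using that by (intro flow_on_subset[OF X(2)]) auto
  qed (simp add: X(1))
  have "x t \<in> F \<and> (x has_vector_derivative - V (x t)) (at t within {0..})" if "t \<ge> 0" for t
  proof -
    obtain n where n: "t \<le> real n" using real_arch_simple by blast
    have nhd: "at t within {0..real n + 1} = at t within {0..}"
      by (rule at_within_nhd[of _ "{..<real n + 1}"]) (use n in auto)
    have t: "t \<in> {0..real n + 1}" using n that by simp
    note Xt = flow_onD[OF X(2) t]
    have "(x has_vector_derivative - V (X n t)) (at t within {0..real n + 1})"
      by (rule has_vector_derivative_transform[OF t _ Xt(4)]) (simp add: eq)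
    then show ?thesis using Xt(1) eq[of t n] t by (simp add: nhd)
  qed
  then have "flow_on {0..} x" by (simp add: flow_on_def)
  moreover have "x 0 = x0" using eq[of 0 0] X(1) by simp
  ultimately show ?thesis by blast
qed

section \<open>Well-posedness\<close>

lemma hsd_solution_iff_flow_on:
  "hsd_solution A b C h f x0 T x \<longleftrightarrow> 0 < T \<and> x 0 = x0 \<and> flow_on {s. 0 \<le> s \<and> ereal s < T} x"
  by (auto simp: hsd_solution_def flow_on_def)

lemma hsd_solution_infinity:
  "hsd_solution A b C h f x0 \<infinity> x \<longleftrightarrow> x 0 = x0 \<and> flow_on {0..} x"
  by (simp add: hsd_solution_iff_flow_on atLeast_def)

text \<open>A maximal solution with finite \<open>T\<close> would agree on \<open>[0, T)\<close>
  with the global trajectory, which would then extend it strictly.\<close>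

lemma hsd_well_posed: "hsd_well_posed A b C h f"
  unfolding hsd_well_posed_def
proof (intro ballI conjI allI impI)
  fix x0 assume "x0 \<in> F"
  then obtain y where y: "y 0 = x0" "flow_on {0..} y" using flow_exists by blast
  then have sol: "hsd_solution A b C h f x0 \<infinity> y" by (simp add: hsd_solution_infinity)
  then show "\<exists>T x. hsd_maximal_solution A b C h f x0 T x"
    unfolding hsd_maximal_solution_def by (auto intro!: exI[of _ \<infinity>] exI[of _ y])
  fix T x assume x: "hsd_maximal_solution A b C h f x0 T x"
  show "T = \<infinity>"
  proof (rule ccontr)
    assume "T \<noteq> \<infinity>"
    then have "T < \<infinity>" by simp
    have "x 0 = x0" "flow_on {s. 0 \<le> s \<and> ereal s < T} x"
      using x by (auto simp: hsd_maximal_solution_def hsd_solution_iff_flow_on)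
    have "y t = x t" if t: "0 \<le> t" "ereal t < T" for t
    proof (rule flow_unique[OF t(1)])
      show "flow_on {0..t} y" using y(2) by (rule flow_on_subset) auto
      have "ereal s < T" if "s \<le> t" for s
        using that t(2) by (simp add: order.strict_trans1[of "ereal s" "ereal t"])
      then show "flow_on {0..t} x"
        using \<open>flow_on {s. 0 \<le> s \<and> ereal s < T} x\<close> by (elim flow_on_subset) auto
    qed (simp add: \<open>x 0 = x0\<close> y(1))
    then show False
      using x sol \<open>T < \<infinity>\<close> unfolding hsd_maximal_solution_def by blast
  qed
next
  fix x0 x y t
  assume "hsd_maximal_solution A b C h f x0 \<infinity> x \<and> hsd_maximal_solution A b C h f x0 \<infinity> y"
    and "0 \<le> (t::real)"
  then have "flow_on {0..} x" "flow_on {0..} y" "x 0 = y 0"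
    by (simp_all add: hsd_maximal_solution_def hsd_solution_infinity)
  moreover have "{0..t} \<subseteq> {0..}" by auto
  ultimately show "x t = y t"
    using flow_unique[OF \<open>0 \<le> t\<close>] flow_on_subset by metis
qed

section \<open>Convergence\<close>

context
  fixes x :: "real \<Rightarrow> real^'n" and x0 :: "real^'n"
  assumes x: "flow_on {0..} x" and x0: "x 0 = x0"
begin

lemma flow_on_interval: "0 \<le> s \<Longrightarrow> flow_on {s..t} x"
  by (rule flow_on_subset[OF x]) auto

lemma flow_converges:
  "\<exists>p \<in> closure F. (x \<longlongrightarrow> p) at_top"
proof -
  obtain R where "\<And>t. t \<ge> 0 \<Longrightarrow> norm (x t) \<le> R"
    using flow_bounded[of x0] flow_on_interval x0 by blast
  then have "bounded (range (\<lambda>j. x (real j)))"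
    unfolding bounded_iff by (intro exI[of _ R]) auto
  then obtain p r where r: "strict_mono r" "((\<lambda>j. x (real j)) \<circ> r) \<longlonglongrightarrow> p"
    using bounded_imp_convergent_subsequence by blast
  define Y where "Y = (\<lambda>j. x (real (r j)))"
  have Y: "Y \<longlonglongrightarrow> p" "\<And>j. Y j \<in> F" "\<And>j. Y j \<in> C"
    using r(2) flow_onD[OF x] by (auto simp: Y_def o_def)
  have p: "p \<in> closure F" using Y closure_sequential by blast
  then have pC: "p \<in> closure C" "A *v p = b"
    using closure_feasible by (auto simp: affine_constraint_def)
  have "filterlim (\<lambda>j. real (r j)) at_top sequentially"
    by (rule filterlim_compose[OF filterlim_real_sequentially filterlim_subseq[OF r(1)]])
  then have late: "\<forall>\<^sub>F j in sequentially. t \<le> real (r j)" for t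
    by (simp add: filterlim_at_top)
  \<comment> \<open>Each \<open>Y j\<close> taken after time \<open>t\<close> has value at most
    \<open>f (x t)\<close>; continuity passes this to the limit.\<close>
  have fp: "f p \<le> f (x t)" if "t \<ge> 0" for t
  proof (rule tendsto_upperbound)
    show "(\<lambda>j. f (Y j)) \<longlonglongrightarrow> f p"
      using continuous_f[of UNIV] Y(1) unfolding continuous_on_sequentially o_def by blast
    show "\<forall>\<^sub>F j in sequentially. f (Y j) \<le> f (x t)"
      using late[of t] unfolding Y_def
      by eventually_elim (rule f_nonincreasing[OF flow_on_interval[OF that]])
  qed simp
  have mono: "D p (x t) \<le> D p (x s)" if "0 \<le> s" "s \<le> t" for s t
    using that by (intro D_nonincreasing flow_on_interval fp pC) auto
  have DY: "(\<lambda>j. D p (Y j)) \<longlonglongrightarrow> 0" by (rule D_tendsto_zero[OF pC(1) Y(3,1)])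
  have D0: "((\<lambda>t. D p (x t)) \<longlongrightarrow> 0) at_top"
  proof (rule tendstoI)
    fix e :: real assume "e > 0"
    then obtain j where "\<bar>D p (Y j)\<bar> < e"
      using tendstoD[OF DY] by (auto simp: eventually_sequentially)
    then have "\<bar>D p (x t)\<bar> < e" if "t \<ge> real (r j)" for t
      using mono[of "real (r j)" t] that D_nonneg[OF flow_onD(2)[OF x, of t] pC(1)]
      by (simp add: Y_def)
    then show "\<forall>\<^sub>F t in at_top. dist (D p (x t)) 0 < e"
      by (auto simp: eventually_at_top_linorder)
  qed
  have "(x \<longlongrightarrow> p) at_top"
  proof (rule tendsto_at_topI_sequentially)
    fix X :: "nat \<Rightarrow> real" assume X: "filterlim X at_top sequentially"
    then have pos: "\<forall>\<^sub>F n in sequentially. 0 \<le> X n" by (simp add: filterlim_at_top)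
    \<comment> \<open>The trajectory is controlled only at nonnegative times, and the truncation
      changes finitely many terms.\<close>
    have "(\<lambda>n. x (max 0 (X n))) \<longlonglongrightarrow> p"
    proof (rule D_tendsto_zero_imp_tendsto[OF pC(1)])
      show "x (max 0 (X j)) \<in> C" for j by (rule flow_onD(2)[OF x]) simp
      show "(\<lambda>j. D p (x (max 0 (X j)))) \<longlonglongrightarrow> 0"
        by (rule Lim_transform_eventually[OF filterlim_compose[OF D0 X]])
          (use pos in \<open>auto elim: eventually_mono\<close>)
    qed
    then show "(\<lambda>n. x (X n)) \<longlonglongrightarrow> p"
      by (rule Lim_transform_eventually) (use pos in \<open>auto elim: eventually_mono\<close>)
  qed
  with p show ?thesis by blast
qed

section \<open>The first-order condition at the limit and optimality\<close>

lemma flow_limit_stationary: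
  assumes p: "p \<in> closure F" and lim: "(x \<longlongrightarrow> p) at_top"
  obtains u where "u \<in> normal_cone (closure C) p"
    and "\<And>v. v \<in> mat_kernel A \<Longrightarrow> (u + grad f p) \<bullet> v = 0"
proof -
  have x0F: "x0 \<in> F" using flow_onD(1)[OF x, of 0] x0 by simp
  have pC: "p \<in> closure C" using p closure_feasible by auto
  obtain c0 c1 where c: "c0 \<ge> 0" "c1 \<ge> 0" "\<And>t. t \<ge> 0 \<Longrightarrow> norm (q (x t)) \<le> c0 + c1 * t"
    using flow_gradient_bound[OF x0F] flow_on_interval x0 by (metis order_refl)
  \<comment> \<open>Linear growth of \<open>q\<close> along the flow makes these averages bounded;
    \<open>U 0\<close> is 0 because the inverse of 0 is 0.\<close>
  define U where "U j = q (x (real j)) /\<^sub>R real j" for j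
  have "norm (U j) \<le> c0 + c1" for j
  proof (cases "j = 0")
    case False
    then have "c0 + c1 * real j \<le> (c0 + c1) * real j"
      using mult_left_mono[of 1 "real j" c0] c(1) by (simp add: algebra_simps)
    then have "norm (q (x (real j))) \<le> (c0 + c1) * real j" using c(3)[of "real j"] by simp
    then show ?thesis using False by (simp add: U_def field_simps)
  qed (use c in \<open>simp add: U_def\<close>)
  then have "bounded (range U)" by (auto simp: bounded_iff)
  then obtain u r where r: "strict_mono r" "(U \<circ> r) \<longlonglongrightarrow> u"
    using bounded_imp_convergent_subsequence by blast
  have r_top: "filterlim (\<lambda>j. real (r j)) at_top sequentially"
    by (rule filterlim_compose[OF filterlim_real_sequentially filterlim_subseq[OF r(1)]])
  have Ur: "(\<lambda>j. U (r j)) \<longlonglongrightarrow> u" using r(2) by (simp add: o_def)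
  have xr: "(\<lambda>j. x (real (r j))) \<longlonglongrightarrow> p" by (rule filterlim_compose[OF lim r_top])
  have xC: "x (real j) \<in> C" for j by (rule flow_onD(2)[OF x]) simp
  have hr: "(\<lambda>j. fin h (x (real (r j)))) \<longlonglongrightarrow> fin h p"
    using xC closure_C by (intro continuous_on_tendsto_compose[OF continuous_h xr pC]) simp
  have "u \<in> normal_cone (closure C) p"
    unfolding normal_cone_def
  proof (intro CollectI ballI)
    fix y assume y: "y \<in> closure C"
    have "(\<lambda>j. (y - x (real (r j))) \<bullet> U (r j)) \<longlonglongrightarrow> (y - p) \<bullet> u"
      by (intro tendsto_intros xr Ur)
    moreover have "(\<lambda>j. (fin h y - fin h (x (real (r j)))) * inverse (real (r j))) \<longlonglongrightarrow> (fin h y - fin h p) * 0"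
      by (intro tendsto_intros hr tendsto_inverse_0_at_top r_top)
    \<comment> \<open>This is the tangent inequality divided by \<open>j\<close>. Its right side
      vanishes in the limit by continuity of \<open>fin h\<close> on the closure; at
      \<open>j = 0\<close> both sides are 0.\<close>
    moreover have "(y - x (real j)) \<bullet> U j \<le> (fin h y - fin h (x (real j))) * inverse (real j)" for j
      using mult_right_mono[OF h_above_tangent[OF xC y], of "inverse (real j)" j]
      by (simp add: U_def inner_commute mult.commute)
    ultimately have "(y - p) \<bullet> u \<le> (fin h y - fin h p) * 0"
      by (intro LIMSEQ_le) auto
    then show "(y - p) \<bullet> u \<le> 0" by simp
  qed
  moreover have "(u + grad f p) \<bullet> v = 0" if v: "v \<in> mat_kernel A" for v
  proof -
    \<comment> \<open>L'Hospital's rule: the numerator has derivative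
      \<open>- (grad f (x t) \<bullet> v)\<close>, which converges because \<open>x t\<close>
      does.\<close>
    have "((\<lambda>t. (q (x t) \<bullet> v) / t) \<longlongrightarrow> - (grad f p \<bullet> v)) at_top"
    proof (rule lhospital_at_top_at_top[where f' = "\<lambda>t. - (grad f (x t) \<bullet> v)" and g' = "\<lambda>_. 1"])
      show "\<forall>\<^sub>F t in at_top. DERIV (\<lambda>t. q (x t) \<bullet> v) t :> - (grad f (x t) \<bullet> v)"
        using eventually_gt_at_top[of 0]
      proof eventually_elim
        case (elim t)
        then have "at t within {0..} = at t" by (intro at_within_interior) simp
        then show ?case
          using has_derivative_q_inner_along_flow[OF x _ v, of t] elim by simp
      qed
      have "((\<lambda>t. grad f (x t)) \<longlongrightarrow> grad f p) at_top"
        by (rule continuous_on_tendsto_compose[OF continuous_grad_f[of UNIV] lim]) auto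
      then show "((\<lambda>t. - (grad f (x t) \<bullet> v) / 1) \<longlongrightarrow> - (grad f p \<bullet> v)) at_top"
        by (auto intro!: tendsto_intros)
    qed (auto intro: filterlim_ident)
    from filterlim_compose[OF this r_top]
    have "(\<lambda>j. U (r j) \<bullet> v) \<longlonglongrightarrow> - (grad f p \<bullet> v)"
      by (simp add: U_def divide_inverse mult.commute)
    moreover have "(\<lambda>j. U (r j) \<bullet> v) \<longlonglongrightarrow> u \<bullet> v"
      by (intro tendsto_intros Ur)
    ultimately have "u \<bullet> v = - (grad f p \<bullet> v)" by (rule LIMSEQ_unique[rotated])
    then show ?thesis by (simp add: inner_add_left)
  qed
  ultimately show ?thesis using that by blast
qed

end

text \<open>For feasible \<open>y\<close>, stationarity gives
  \<open>grad f p \<bullet> (y - p) = - (u \<bullet> (y - p))\<close>, nonnegative by normality of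
  \<open>u\<close>; convexity bounds \<open>f y - f p\<close> below by this quantity.\<close>

lemma stationary_imp_optimal:
  assumes p: "p \<in> closure F" and u: "u \<in> normal_cone (closure C) p"
    and stat: "\<And>v. v \<in> mat_kernel A \<Longrightarrow> (u + grad f p) \<bullet> v = 0" and conv: "convex_on UNIV f"
  shows "p \<in> optimal_solutions A b C f"
proof -
  have pF: "p \<in> closure C \<inter> affine_constraint A b" using p closure_feasible by simp
  have "f p \<le> f y" if y: "y \<in> closure C \<inter> affine_constraint A b" for y
  proof -
    have "grad f p \<bullet> (y - p) \<le> f y - f p"
    proof (rule inner_grad_le_of_segment[OF derivative_f])
      fix s :: real assume "0 < s" "s \<le> 1"
      then have "f ((1 - s) *\<^sub>R p + s *\<^sub>R y) \<le> (1 - s) * f p + s * f y"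
        using convex_onD[OF conv, of s p y] by simp
      then show "f (p + s *\<^sub>R (y - p)) \<le> f p + s * (f y - f p)"
        by (simp add: algebra_simps)
    qed
    moreover have "y - p \<in> mat_kernel A"
      using y pF by (intro diff_in_kernel) (auto simp: affine_constraint_def)
    then have "(u + grad f p) \<bullet> (y - p) = 0" by (rule stat)
    moreover have "(y - p) \<bullet> u \<le> 0" using u y by (simp add: normal_cone_def)
    ultimately show ?thesis by (simp add: inner_add_left inner_commute[of u])
  qed
  with pF show ?thesis by (simp add: optimal_solutions_def)
qed

end

theorem theorem4p2:
  fixes A :: "real^'n^'m" and b :: "real^'m" and C :: "(real^'n) set"
    and f :: "real^'n \<Rightarrow> real" and h :: "real^'n \<Rightarrow> ereal"
  assumes "CARD('m) < CARD('n)"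
    and "rank A = CARD('m)"
    and "b \<in> range ((*v) A)"
    and "C \<noteq> {}" and "open C" and "convex C"
    and "feasible A b C \<noteq> {}"
    and "closure (feasible A b C) = closure C \<inter> affine_constraint A b"
    and "C1_on UNIV f" and "locally_lipschitz_on UNIV (grad f)"
    and "legendre_type h" and "interior (effective_domain h) = C"
    and "C2_on C (fin h)"
    and "\<forall>x\<in>C. transpose (hess (fin h) x) = hess (fin h) x \<and> pos_def_matrix (hess (fin h) x)"
    and "locally_lipschitz_on C (hess (fin h))"
    and "bregman_function C h"
    and "quasi_convex f"
    and "optimal_solutions A b C f \<noteq> {}"
  shows "hsd_well_posed A b C h f \<and>
    (\<forall>x0 \<in> feasible A b C. \<forall>x. hsd_maximal_solution A b C h f x0 \<infinity> x \<longrightarrow>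
      (\<exists>xs \<in> closure (feasible A b C).
         (x \<longlongrightarrow> xs) at_top \<and>
         - grad f xs \<in> normal_cone (closure C) xs + orthogonal_comp (mat_kernel A) \<and>
         (convex_on UNIV f \<longrightarrow> xs \<in> optimal_solutions A b C f)))"
proof -
  interpret hessian_gradient_flow A b C f h
    using assms by unfold_locales (auto simp: legendre_type_def)
  have "\<exists>p \<in> closure F. (x \<longlongrightarrow> p) at_top \<and>
      - grad f p \<in> normal_cone (closure C) p + orthogonal_comp (mat_kernel A) \<and>
      (convex_on UNIV f \<longrightarrow> p \<in> optimal_solutions A b C f)"
    if "hsd_maximal_solution A b C h f x0 \<infinity> x" for x0 x
  proof -
    have x: "flow_on {0..} x" "x 0 = x0"
      using that by (simp_all add: hsd_maximal_solution_def hsd_solution_infinity)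
    obtain p where p: "p \<in> closure F" "(x \<longlongrightarrow> p) at_top"
      using flow_converges[OF x] by blast
    obtain u where u: "u \<in> normal_cone (closure C) p"
      "\<And>v. v \<in> mat_kernel A \<Longrightarrow> (u + grad f p) \<bullet> v = 0"
      using flow_limit_stationary[OF x p] by blast
    \<comment> \<open>Splits \<open>- grad f p\<close> as the normal vector \<open>u\<close> plus a
      vector orthogonal to the kernel of \<open>A\<close>.\<close>
    have "- (u + grad f p) \<in> orthogonal_comp (mat_kernel A)"
      using u(2) by (auto simp: orthogonal_comp_def orthogonal_def inner_commute simp del: minus_add_distrib)
    from set_plus_intro[OF u(1) this]
    have "- grad f p \<in> normal_cone (closure C) p + orthogonal_comp (mat_kernel A)" by simp
    then show ?thesis using p stationary_imp_optimal[OF p(1) u] by blast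
  qed
  then show ?thesis using hsd_well_posed by blast
qed

end
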